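(* Let $G$ be the stable LTI system with coefficient matrices $(A,B,C,D)$, let $A_p\in\mathbb{R}^{n_p\times n_p}$ be Hurwitz and Metzler, and let $B_p\in\mathbb{R}_+^{n_p\times n_w}$. Let $\overline{\gamma},\overline{\overline{\gamma}}$ be the filter-free bounds and $\overline{\gamma}_a,\overline{\overline{\gamma}}_a$ the positive-filter-based bounds defined in the context. Then $$\overline{\gamma}_a\le\overline{\gamma}\ (\le\|G\|_2),\qquad \overline{\overline{\gamma}}_a\le\overline{\overline{\gamma}}\ (\le\|G\|_2).$$
   Context: Notation: $\mathbb{S}^k$ is the set of $k\times k$ real symmetric matrices; $X\preceq 0$ means $X$ is negative semidefinite. $\mathbb{R}_+^{k\times l}$ is the set of entrywise nonnegative real $k\times l$ matrices. A matrix is Hurwitz if all its eigenvalues have negative real part, and Metzler if all its off-diagonal entries are nonnegative. $\mathrm{PSD}^k\subset\mathbb{S}^k$ is the positive semidefinite cone; $\mathrm{NN}^k=\{P\in\mathbb{S}^k: P\ge 0 \text{ entrywise}\}$; $\mathrm{PSD}^k+\mathrm{NN}^k$ is their Minkowski sum; $\mathrm{COP}^k=\{P\in\mathbb{S}^k:\ x^TPx\ge 0\ \text{for all } x\in\mathbb{R}^k \text{ with } x\ge 0 \text{ entrywise}\}$ is the copositive cone. System: $G$ is the continuous-time LTI system $\dot x(t)=Ax(t)+Bw(t)$, $x(0)=0$, $z(t)=Cx(t)+Dw(t)$, with $A\in\mathbb{R}^{n\times n}$, $B\in\mathbb{R}^{n\times n_w}$, $C\in\mathbb{R}^{n_z\times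 n}$, $D\in\mathbb{R}^{n_z\times n_w}$. Standing assumptions: $A$ is Hurwitz and $(A,B)$ is controllable. $\|G\|_2=\sup_{w\in L_2,\ \|w\|_2=1}\|z\|_2$ is the standard $L_2$ induced norm, where $\|w\|_2=\sqrt{\int_0^\infty |w(t)|_2^2\,dt}$ and $L_2=\{w:\|w\|_2<\infty\}$. Filter-free bounds: consider the inequality $$(\ast)\quad \begin{bmatrix} PA+A^TP+C^TC & PB+C^TD\\ B^TP+D^TC & D^TD-\gamma^2I_{n_w}+Q\end{bmatrix}\preceq 0 .$$ $\overline{\gamma}$ is the infimum of $\gamma>0$ such that $(\ast)$ holds for some $P\in\mathrm{PSD}^n$, $Q\in\mathrm{COP}^{n_w}$; $\overline{\overline{\gamma}}$ is the infimum of $\gamma>0$ such that $(\ast)$ holds for some $P\in\mathrm{PSD}^n$, $Q\in\mathrm{PSD}^{n_w}+\mathrm{NN}^{n_w}$. Positive-filter-based bounds: put $$A_a=\begin{bmatrix}A&0\\ 0&A_p\end{bmatrix},\quad B_a=\begin{bmatrix}B\\ B_p\end{bmatrix},\quad C_a=\begin{bmatrix}C&0_{n_z,n_p}\end{bmatrix},\quad D_a=D,$$ and consider the inequality $$(\ast\ast)\quad\begin{bmatrix} P_aA_a + A_a^T P_a + C_a^T C_a & P_aB_a + C_a^T D_a \\ B_a^T P_a + D_a^T C_a & D_a^T D_a- \gamma ^2 I_{n_w} \end{bmatrix} + \begin{bmatrix} 0_{n,n_p+n_w} \\ I_{n_p+n_w} \end{bmatrix} Q_a \begin{bmatrix} 0_{n,n_p+n_w}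 \\ I_{n_p+n_w} \end{bmatrix}^T \preceq 0 .$$ $\overline{\gamma}_a$ is the infimum of $\gamma>0$ such that $(\ast\ast)$ holds for some $P_a\in\mathbb{S}^{n+n_p}$, $Q_a\in\mathrm{COP}^{n_p+n_w}$; $\overline{\overline{\gamma}}_a$ is the infimum of $\gamma>0$ such that $(\ast\ast)$ holds for some $P_a\in\mathbb{S}^{n+n_p}$, $Q_a\in\mathrm{PSD}^{n_p+n_w}+\mathrm{NN}^{n_p+n_w}$. *)

theory Defs
  imports "HOL-Analysis.Analysis"
begin

section \<open>Matrix classes and matrix cones\<close>

definition hurwitz :: "real^'n^'n \<Rightarrow> bool" where
  "hurwitz A \<longleftrightarrow>
     (\<forall>(l::complex) v. v \<noteq> 0 \<and> map_matrix complex_of_real A *v v = l *s v \<longrightarrow> Re l < 0)"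

definition metzler :: "real^'n^'n \<Rightarrow> bool" where
  "metzler A \<longleftrightarrow> (\<forall>i j. i \<noteq> j \<longrightarrow> 0 \<le> A $ i $ j)"

definition entrywise_nonneg :: "real^'n^'m \<Rightarrow> bool" where
  "entrywise_nonneg M \<longleftrightarrow> (\<forall>i j. 0 \<le> M $ i $ j)"

definition Sym :: "(real^'n^'n) set" where
  "Sym = {P. transpose P = P}"

definition PSD :: "(real^'n^'n) set" where
  "PSD = {P \<in> Sym. \<forall>x. 0 \<le> x \<bullet> (P *v x)}"

definition NN :: "(real^'n^'n) set" where
  "NN = {P \<in> Sym. entrywise_nonneg P}"

definition COP :: "(real^'n^'n) set" where
  "COP = {P \<in> Sym. \<forall>x. (\<forall>i. 0 \<le> x $ i) \<longrightarrow> 0 \<le> x \<bullet> (P *v x)}"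

definition neg_semidef :: "real^'n^'n \<Rightarrow> bool" where
  "neg_semidef M \<longleftrightarrow> M \<in> Sym \<and> (\<forall>x. x \<bullet> (M *v x) \<le> 0)"


section \<open>Block matrices\<close>

text \<open>Matrices of size $(a+b) \times c$ and $a \times (c+d)$ are indexed by sum types.\<close>

definition vstack :: "'e^'c^'a \<Rightarrow> 'e^'c^'b \<Rightarrow> 'e^'c^('a + 'b)" where
  "vstack M N = (\<chi> i j. case i of Inl a \<Rightarrow> M $ a $ j | Inr b \<Rightarrow> N $ b $ j)"

definition hstack :: "'e^'c^'a \<Rightarrow> 'e^'d^'a \<Rightarrow> 'e^('c + 'd)^'a" where
  "hstack M N = (\<chi> i j. case j of Inl c \<Rightarrow> M $ i $ c | Inr d \<Rightarrow> N $ i $ d)"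

definition block :: "'e^'c^'a \<Rightarrow> 'e^'d^'a \<Rightarrow> 'e^'c^'b \<Rightarrow> 'e^'d^'b \<Rightarrow> 'e^('c + 'd)^('a + 'b)" where
  "block M11 M12 M21 M22 = vstack (hstack M11 M12) (hstack M21 M22)"


section \<open>Signals and the continuous-time system\<close>

text \<open>Signals are functions on \<^typ>\<open>real\<close> of which only the restriction to $[0,\infty)$
  matters. The norm takes the value \<open>\<infinity>\<close> for signals that are not square integrable.\<close>

definition l2_norm :: "(real \<Rightarrow> 'a::euclidean_space) \<Rightarrow> ereal" where
  "l2_norm w =
     (let I = (\<integral>\<^sup>+ t. ennreal ((norm (w t))\<^sup>2) \<partial>lebesgue_on {0..})
      in if I = \<infinity> then \<infinity> else ereal (sqrt (enn2real I)))"

definition L2 :: "(real \<Rightarrow> 'a::euclidean_space) set" where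
  "L2 = {w \<in> borel_measurable (lebesgue_on {0..}). l2_norm w < \<infinity>}"

text \<open>Since $w$ need not be continuous, $\dot x = Ax + Bw$, $x(0) = x_0$ is understood in the
  sense of Caratheodory, that is, as the integral equation
  $x(t) = x_0 + \int_0^t (A x(s) + B w(s))\,ds$. For $w \in L_2$ the use of \<open>has_integral\<close> forces
  $x$ to be continuous (an indefinite integral), so this agrees with the Lebesgue version.\<close>

definition state_trajectory ::
  "real^'n^'n \<Rightarrow> real^'w^'n \<Rightarrow> real^'n \<Rightarrow> (real \<Rightarrow> real^'w) \<Rightarrow> (real \<Rightarrow> real^'n) \<Rightarrow> bool" where
  "state_trajectory A B x0 w x \<longleftrightarrow>
     (\<forall>t\<ge>0. ((\<lambda>s. A *v x s + B *v w s) has_integral (x t - x0)) {0..t})"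

definition controllable :: "real^'n^'n \<Rightarrow> real^'w^'n \<Rightarrow> bool" where
  "controllable A B \<longleftrightarrow>
     (\<forall>x0 x1. \<exists>T>0. \<exists>w\<in>L2. \<exists>x. state_trajectory A B x0 w x \<and> x T = x1)"

definition L2_gain ::
  "real^'n^'n \<Rightarrow> real^'w^'n \<Rightarrow> real^'n^'z \<Rightarrow> real^'w^'z \<Rightarrow> ereal" where
  "L2_gain A B C D =
     Sup {l2_norm (\<lambda>t. C *v x t + D *v w t) | w x.
            w \<in> L2 \<and> l2_norm w = 1 \<and> state_trajectory A B 0 w x}"


section \<open>The bounds\<close>

text \<open>All infima are taken in the extended reals, so that an infeasible problem has value
  \<open>\<infinity>\<close>. The multiplier cone is a parameter.\<close>

definition lmi ::
  "real^'n^'n \<Rightarrow> real^'w^'n \<Rightarrow> real^'n^'z \<Rightarrow> real^'w^'z \<Rightarrow> real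
    \<Rightarrow> real^'n^'n \<Rightarrow> real^('n + 'w)^('n + 'w)" where
  "lmi A B C D \<gamma> P =
     block (P ** A + transpose A ** P + transpose C ** C)
           (P ** B + transpose C ** D)
           (transpose B ** P + transpose D ** C)
           (transpose D ** D - \<gamma>\<^sup>2 *\<^sub>R mat 1)"

definition gamma_bound ::
  "real^'n^'n \<Rightarrow> real^'w^'n \<Rightarrow> real^'n^'z \<Rightarrow> real^'w^'z \<Rightarrow> (real^'w^'w) set \<Rightarrow> ereal" where
  "gamma_bound A B C D K =
     Inf {ereal \<gamma> | \<gamma>. \<gamma> > 0 \<and>
            (\<exists>P\<in>PSD. \<exists>Q\<in>K. neg_semidef (lmi A B C D \<gamma> P + block 0 0 0 Q))}"

definition aug_A :: "real^'n^'n \<Rightarrow> real^'p^'p \<Rightarrow> real^('n + 'p)^('n + 'p)" where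
  "aug_A A Ap = block A 0 0 Ap"

definition aug_B :: "real^'w^'n \<Rightarrow> real^'w^'p \<Rightarrow> real^'w^('n + 'p)" where
  "aug_B B Bp = vstack B Bp"

definition aug_C :: "real^'n^'z \<Rightarrow> real^('n + 'p::finite)^'z" where
  "aug_C C = hstack C 0"

text \<open>The matrix $[0;\, I_{n_p+n_w}]$, with its rows grouped as $(n + n_p) + n_w$ to match the
  augmented inequality.\<close>

definition aug_E :: "real^('p::finite + 'w::finite)^(('n::finite + 'p) + 'w)" where
  "aug_E = vstack (vstack 0 (hstack (mat 1) 0)) (hstack 0 (mat 1))"

definition gamma_bound_aug ::
  "real^'n^'n \<Rightarrow> real^'w^'n \<Rightarrow> real^'n^'z \<Rightarrow> real^'w^'z \<Rightarrow> real^'p^'p \<Rightarrow> real^'w^'p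
    \<Rightarrow> (real^('p + 'w)^('p + 'w)) set \<Rightarrow> ereal" where
  "gamma_bound_aug A B C D Ap Bp K =
     Inf {ereal \<gamma> | \<gamma>. \<gamma> > 0 \<and>
            (\<exists>Pa\<in>Sym. \<exists>Qa\<in>K.
               neg_semidef (lmi (aug_A A Ap) (aug_B B Bp) (aug_C C) D \<gamma> Pa
                            + aug_E ** Qa ** transpose aug_E))}"

end

theory Submission
  imports Defs
begin

text \<open>
  The comparison with the filter-free bound is a matter of padding: a solution \<open>(P, Q)\<close> of the
  filter-free inequality gives the solution \<open>diag(P, 0)\<close>, \<open>diag(0, Q)\<close> of the augmented one with the
  same \<open>\<gamma>\<close>, because the quadratic form of the augmented inequality then does not see the filter
  state at all and reduces to the filter-free form (\<open>gamma_bound_aug_le_gamma_bound\<close>). Both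
  multiplier cones are closed under this padding.

  The comparison with the induced norm takes the multiplier \<open>Q = 0\<close>, so it is the direction
  ``gain bound implies linear matrix inequality'' of the bounded real lemma, for every \<open>g\<close> with
  \<open>L2_gain A B C D \<le> g\<close>. It is proved in the time domain, following Willems. Along a trajectory let
  the supply rate be \<open>g\<^sup>2|w|\<^sup>2 - |z|\<^sup>2\<close>, and let the required supply \<open>V(\<xi>)\<close> be the infimum of the total
  supply over all finite trajectories that lead from the origin to \<open>\<xi>\<close>.

  \<^item> The set of such trajectories is nonempty by controllability, and their total supply is
    nonnegative by the gain bound: continue the trajectory with zero input for ever and compare
    norms on \<open>[0,\<infinity>)\<close> (\<open>total_supply_nonneg\<close>). Hence \<open>V\<close> is finite and nonnegative.
  \<^item> The supply rate is a quadratic form and trajectories from the origin form a vector space, so \<open>V\<close>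
    inherits homogeneity and the parallelogram law (\<open>required_supply_parallelogram\<close>). A nonnegative
    function with these two properties is a quadratic form, \<open>V(\<xi>) = \<xi> \<bullet> P \<xi>\<close> with \<open>P\<close> positive
    semidefinite (\<open>parallelogram_imp_quadratic_form\<close>).
  \<^item> Prolonging a nearly optimal trajectory by an arc with constant input \<open>u\<close> shows that \<open>V\<close> grows at
    most by the supply along that arc (\<open>required_supply_dissipation\<close>). Differentiating at the
    beginning of the arc gives \<open>2 \<xi> \<bullet> P(A\<xi> + Bu) \<le> g\<^sup>2|u|\<^sup>2 - |C\<xi> + Du|\<^sup>2\<close> for all \<open>\<xi>\<close> and \<open>u\<close>, and this is
    the matrix inequality (\<open>storage_matrix_exists\<close>).
\<close>

section \<open>Functions satisfying the parallelogram law\<close>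

text \<open>Additivity determines \<open>f\<close> on the integers, so \<open>f s - s f(1)\<close> depends only on the fractional part
  of \<open>s\<close> and is therefore bounded on the whole line. An additive bounded function vanishes.\<close>

lemma additive_locally_bounded_imp_linear:
  fixes f :: "real \<Rightarrow> real"
  assumes add: "\<And>s t. f (s + t) = f s + f t"
    and bdd: "\<And>t. 0 \<le> t \<Longrightarrow> t \<le> 1 \<Longrightarrow> \<bar>f t\<bar> \<le> M"
  shows "f t = t * f 1"
proof -
  have nat_mult: "f (of_nat n * t) = of_nat n * f t" for n t
  proof (induction n)
    case 0 show ?case using add[of 0 0] by simp
  next
    case (Suc n) then show ?case using add[of t "of_nat n * t"] by (simp add: algebra_simps)
  qed
  have neg: "f (- t) = - f t" for t using add[of t "- t"] add[of 0 0] by simp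
  have int_val: "f (of_int m) = of_int m * f 1" for m
  proof (cases m rule: int_cases2)
    case (nonneg n) then show ?thesis using nat_mult[of n 1] by simp
  next
    case (nonpos n) then show ?thesis using nat_mult[of n 1] neg[of "of_nat n"] by simp
  qed
  have dev: "\<bar>f s - s * f 1\<bar> \<le> M + \<bar>f 1\<bar>" for s
  proof -
    have "f s = f (of_int \<lfloor>s\<rfloor>) + f (frac s)" using add[of "of_int \<lfloor>s\<rfloor>" "frac s"]
      by (simp add: frac_def)
    then have "f s - s * f 1 = f (frac s) - frac s * f 1"
      by (simp add: int_val frac_def algebra_simps)
    moreover have "\<bar>f (frac s)\<bar> \<le> M" using bdd[of "frac s"] frac_lt_1[of s] by simp
    moreover have "\<bar>frac s * f 1\<bar> \<le> 1 * \<bar>f 1\<bar>"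
      unfolding abs_mult using frac_lt_1[of s] by (intro mult_right_mono) auto
    ultimately show ?thesis by linarith
  qed
  have scaled: "of_nat n * \<bar>f t - t * f 1\<bar> \<le> M + \<bar>f 1\<bar>" for n
    using dev[of "of_nat n * t"] nat_mult[of n t]
    by (simp add: abs_mult flip: right_diff_distrib mult.assoc)
      (simp add: abs_mult right_diff_distrib[symmetric] mult.assoc)
  show ?thesis
  proof (rule ccontr)
    assume "f t \<noteq> t * f 1"
    then have "\<bar>f t - t * f 1\<bar> > 0" by simp
    then obtain n where "of_nat n * \<bar>f t - t * f 1\<bar> > M + \<bar>f 1\<bar>"
      using reals_Archimedean3 by blast
    then show False using scaled[of n] by linarith
  qed
qed

text \<open>The theorem of Jordan and von Neumann for a possibly degenerate \<open>V\<close>. The polar form \<open>b\<close> is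
  biadditive by the parallelogram law, and nonnegativity of \<open>V\<close> bounds \<open>t \<mapsto> b (t x) y\<close> on \<open>[0,1]\<close>,
  which upgrades additivity to real homogeneity.\<close>

lemma parallelogram_imp_quadratic_form:
  fixes V :: "real^'n \<Rightarrow> real"
  assumes nonneg: "\<And>x. 0 \<le> V x"
    and hom: "\<And>c x. V (c *\<^sub>R x) = c\<^sup>2 * V x"
    and par: "\<And>x y. V (x + y) + V (x - y) = 2 * V x + 2 * V y"
  obtains P where "P \<in> PSD" "\<And>x. V x = x \<bullet> (P *v x)"
proof -
  define b where "b x y = (V (x + y) - V (x - y)) / 4" for x y
  have even: "V (- x) = V x" for x using hom[of "-1" x] by simp
  have even_diff: "V (x - y) = V (y - x)" for x y using even[of "x - y"] by simp
  have sym: "b x y = b y x" for x y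
    by (simp add: b_def even_diff[of x y] add.commute)
  have jensen: "b (x + x') y + b (x - x') y = 2 * b x y" for x x' y
    using par[of "x + y" x'] par[of "x - y" x'] by (simp add: b_def algebra_simps) (simp add: field_simps)
  have minus: "b (- x) y = - b x y" for x y
  proof -
    have "V (- x + y) = V (x - y)" "V (- x - y) = V (x + y)"
      using even[of "x + y"] even_diff[of x y] by simp_all
    then have "V (- x + y) - V (- x - y) = - (V (x + y) - V (x - y))" by simp
    then show ?thesis unfolding b_def by (simp only: minus_divide_left)
  qed
  have add: "b (x + x') y = b x y + b x' y" for x x' y
    using jensen[of x x' y] jensen[of x' x y] minus[of "x - x'" y] by (simp add: add.commute)
  have scale: "b (c *\<^sub>R x) y = c * b x y" for c x y
  proof -
    have "b (t *\<^sub>R x) y = t * b (1 *\<^sub>R x) y" for t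
    proof (rule additive_locally_bounded_imp_linear)
      show "b ((s + t) *\<^sub>R x) y = b (s *\<^sub>R x) y + b (t *\<^sub>R x) y" for s t
        by (simp add: scaleR_add_left add)
      show "\<bar>b (t *\<^sub>R x) y\<bar> \<le> V x + V y" if t: "0 \<le> t" "t \<le> 1" for t
      proof -
        have "t\<^sup>2 * V x \<le> 1 * V x" using t nonneg by (intro mult_right_mono) (auto simp: power_le_one)
        then have "V (t *\<^sub>R x + y) + V (t *\<^sub>R x - y) \<le> 2 * V x + 2 * V y"
          using par[of "t *\<^sub>R x" y] hom[of t x] by simp
        then show ?thesis
          using nonneg[of "t *\<^sub>R x + y"] nonneg[of "t *\<^sub>R x - y"] nonneg[of x] nonneg[of y]
          unfolding b_def by (simp add: abs_le_iff pos_divide_le_eq minus_divide_left)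
      qed
    qed
    then show ?thesis by simp
  qed
  have lin: "linear (\<lambda>x. b x y)" for y
    by (rule linearI) (simp_all add: add scale)
  define P :: "real^'n^'n" where "P = (\<chi> i j. b (axis i 1) (axis j 1))"
  have expand: "b x y = (\<Sum>i\<in>UNIV. x $ i * b (axis i 1) y)" for x y
  proof -
    have "b x y = b (\<Sum>i\<in>UNIV. x $ i *\<^sub>R axis i 1) y"
      using basis_expansion[of x] by (simp add: scalar_mult_eq_scaleR)
    also have "\<dots> = (\<Sum>i\<in>UNIV. x $ i * b (axis i 1) y)"
      by (subst linear_sum[OF lin]) (simp add: scale)
    finally show ?thesis .
  qed
  have row: "(P *v y) $ i = b (axis i 1) y" for i y
    unfolding sym[of "axis i 1" y] expand[of y]
    by (simp add: matrix_vector_mult_def P_def sym[of "axis i 1"] mult.commute)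
  have form: "V x = x \<bullet> (P *v x)" for x
  proof -
    have "V x = b x x" using hom[of 2 x] hom[of 0 x]
      by (simp add: b_def scaleR_2)
    also have "\<dots> = x \<bullet> (P *v x)" unfolding expand[of x x] by (simp add: inner_vec_def row)
    finally show ?thesis .
  qed
  have "transpose P = P" by (simp add: transpose_def P_def vec_eq_iff sym)
  then have "P \<in> PSD" using nonneg form by (simp add: PSD_def Sym_def)
  then show ?thesis using that form by blast
qed


section \<open>Block matrices and padding of multipliers\<close>

definition upper :: "'e^('a::finite + 'b::finite) \<Rightarrow> 'e^'a" where
  "upper v = (\<chi> i. v $ Inl i)"

definition lower :: "'e^('a::finite + 'b::finite) \<Rightarrow> 'e^'b" where
  "lower v = (\<chi> i. v $ Inr i)"

lemma upper_add: "upper (v + w) = upper v + upper w"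
  for v :: "real^('a::finite + 'b::finite)"
  by (simp add: upper_def vec_eq_iff)

lemma sum_UNIV_Plus:
  "(\<Sum>i\<in>UNIV. f i) = (\<Sum>a\<in>UNIV. f (Inl a)) + (\<Sum>b\<in>UNIV. f (Inr b))"
  for f :: "'a::finite + 'b::finite \<Rightarrow> 'e::comm_monoid_add"
proof -
  have "(\<Sum>i\<in>UNIV. f i) = (\<Sum>i\<in>range Inl. f i) + (\<Sum>i\<in>range Inr. f i)"
    unfolding UNIV_sum by (rule sum.union_disjoint) auto
  then show ?thesis by (simp add: sum.reindex)
qed

lemma inner_sum_index: "v \<bullet> w = upper v \<bullet> upper w + lower v \<bullet> lower w"
  for v :: "real^('a::finite + 'b::finite)"
  by (simp add: inner_vec_def upper_def lower_def sum_UNIV_Plus)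

lemma vstack_mult:
  fixes M :: "real^'c^'a" and N :: "real^'c^'b"
  shows "upper (vstack M N *v v) = M *v v" "lower (vstack M N *v v) = N *v v"
  by (simp_all add: upper_def lower_def vstack_def matrix_vector_mult_def)

lemma hstack_mult: "hstack M N *v v = M *v upper v + N *v lower v"
  for M :: "real^'c^'a" and N :: "real^'d^'a"
  by (simp add: upper_def lower_def hstack_def matrix_vector_mult_def sum_UNIV_Plus vec_eq_iff)

lemma block_mult:
  fixes M :: "real^'c^'a" and Q :: "real^'d^'b"
  shows "upper (block M N L Q *v v) = M *v upper v + N *v lower v"
    and "lower (block M N L Q *v v) = L *v upper v + Q *v lower v"
  by (simp_all add: block_def vstack_mult hstack_mult)

lemma transpose_block:
  "transpose (block M N L Q) = block (transpose M) (transpose L) (transpose N) (transpose Q)"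
  by (simp add: block_def vstack_def hstack_def transpose_def vec_eq_iff split: sum.split)

lemma transpose_add: "transpose (M + N) = transpose M + transpose N"
  for M :: "real^'n^'m"
  by (simp add: transpose_def vec_eq_iff)

lemma transpose_zero: "transpose (0 :: real^'n^'m) = 0"
  by (simp add: transpose_def vec_eq_iff)

lemma inner_vector_matrix_mult: "x \<bullet> (y v* M) = y \<bullet> (M *v x)"
  for M :: "real^'n^'m"
  by (metis dot_lmul_matrix inner_commute)

lemma Sym_inner:
  assumes "P \<in> Sym"
  shows "(P *v a) \<bullet> b = a \<bullet> (P *v b)"
  using assms inner_vector_matrix_mult[of b a P]
  by (metis (mono_tags, lifting) Sym_def inner_commute mem_Collect_eq transpose_matrix_vector)

lemma Sym_add: "M \<in> Sym \<Longrightarrow> N \<in> Sym \<Longrightarrow> M + N \<in> Sym"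
  by (simp add: Sym_def transpose_add)

lemma lmi_Sym:
  fixes A :: "real^'n^'n" and B :: "real^'w^'n" and C :: "real^'n^'z" and D :: "real^'w^'z"
  assumes "P \<in> Sym"
  shows "lmi A B C D \<gamma> P \<in> Sym"
proof -
  have P: "transpose P = P" using assms by (simp add: Sym_def)
  have "transpose (transpose D ** D - \<gamma>\<^sup>2 *\<^sub>R mat 1 :: real^'w^'w) = transpose D ** D - \<gamma>\<^sup>2 *\<^sub>R mat 1"
  proof -
    have "transpose (X - \<gamma>\<^sup>2 *\<^sub>R mat 1) = transpose X - \<gamma>\<^sup>2 *\<^sub>R mat 1" for X :: "real^'w^'w"
      by (simp add: transpose_def vec_eq_iff mat_def)
    then show ?thesis by (simp add: matrix_transpose_mul)
  qed
  then show ?thesis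
    unfolding Sym_def lmi_def
    by (simp add: transpose_block transpose_add matrix_transpose_mul P ac_simps)
qed

text \<open>The form of the matrix inequality at \<open>(x, u)\<close> is the derivative of \<open>x \<bullet> P x\<close> along
  \<open>x' = A x + B u\<close>, plus \<open>|z|\<^sup>2 - \<gamma>\<^sup>2|u|\<^sup>2\<close> for the output \<open>z = C x + D u\<close>.\<close>

lemma lmi_form:
  fixes A :: "real^'n^'n" and B :: "real^'w^'n" and C :: "real^'n^'z" and D :: "real^'w^'z"
  assumes "P \<in> Sym"
  shows "v \<bullet> (lmi A B C D \<gamma> P *v v) =
           2 * (upper v \<bullet> (P *v (A *v upper v + B *v lower v)))
           + (norm (C *v upper v + D *v lower v))\<^sup>2 - \<gamma>\<^sup>2 * (norm (lower v))\<^sup>2"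
proof -
  note P = Sym_inner[OF assms]
  have "(\<gamma>\<^sup>2 *\<^sub>R mat 1 :: real^'w^'w) *v lower v = \<gamma>\<^sup>2 *\<^sub>R lower v"
    by (simp add: scaleR_matrix_vector_assoc[symmetric])
  then show ?thesis
    unfolding inner_sum_index lmi_def block_mult power2_norm_eq_inner
    by (simp add: matrix_vector_mult_add_rdistrib matrix_vector_mult_diff_rdistrib
        matrix_vector_mul_assoc[symmetric] matrix_vector_right_distrib inner_add_left
        inner_add_right inner_diff_right inner_vector_matrix_mult P
        inner_commute[of "D *v lower v" "C *v upper v"])
qed

lemma lower_mult_aug_E:
  "lower (v v* (aug_E :: real^('p::finite + 'w::finite)^(('n::finite + 'p) + 'w))) = lower v"
  by (simp add: aug_E_def vstack_def hstack_def vector_matrix_mult_def mat_def lower_def vec_eq_iff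
        sum_UNIV_Plus if_distrib if_distribR cong: if_cong)

text \<open>With \<open>Pa = diag(P, 0)\<close> and \<open>Qa = diag(0, Q)\<close>, the augmented form at \<open>((x, p), u)\<close> equals the
  original form at \<open>(x, u)\<close>: the filter state \<open>p\<close> drops out.\<close>

lemma gamma_bound_aug_le_gamma_bound:
  fixes A :: "real^'n^'n" and B :: "real^'w^'n" and C :: "real^'n^'z" and D :: "real^'w^'z"
    and Ap :: "real^'p^'p" and Bp :: "real^'w^'p"
  assumes pad: "\<And>Q. Q \<in> K \<Longrightarrow> block 0 0 0 Q \<in> Ka" and sym_a: "Ka \<subseteq> Sym"
  shows "gamma_bound_aug A B C D Ap Bp Ka \<le> gamma_bound A B C D K"
  unfolding gamma_bound_aug_def gamma_bound_def
proof (rule Inf_superset_mono, safe)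
  fix \<gamma> :: real and P Q
  assume \<gamma>: "\<gamma> > 0" and P: "P \<in> PSD" and Q: "Q \<in> K"
    and nsd: "neg_semidef (lmi A B C D \<gamma> P + block 0 0 0 Q)"
  define Pa :: "real^('n + 'p)^('n + 'p)" where "Pa = block P 0 0 0"
  define Qa :: "real^('p + 'w)^('p + 'w)" where "Qa = block 0 0 0 Q"
  define E where "E = (aug_E :: real^('p + 'w)^(('n + 'p) + 'w))"
  define M where "M = lmi (aug_A A Ap) (aug_B B Bp) (aug_C C) D \<gamma> Pa + E ** Qa ** transpose E"
  have symP: "P \<in> Sym" using P by (simp add: PSD_def)
  then have symPa: "Pa \<in> Sym" by (simp add: Sym_def Pa_def transpose_block transpose_zero)
  have Qa: "Qa \<in> Ka" unfolding Qa_def by (rule pad[OF Q])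
  then have "transpose Qa = Qa" using sym_a by (auto simp: Sym_def)
  then have "E ** Qa ** transpose E \<in> Sym" by (simp add: Sym_def matrix_transpose_mul matrix_mul_assoc)
  then have "M \<in> Sym" unfolding M_def by (intro Sym_add lmi_Sym symPa)
  moreover have "v \<bullet> (M *v v) \<le> 0" for v
  proof -
    \<comment> \<open>the vector without its filter component\<close>
    define r :: "real^('n + 'w)" where
      "r = (\<chi> i. case i of Inl a \<Rightarrow> v $ Inl (Inl a) | Inr b \<Rightarrow> v $ Inr b)"
    have r: "upper r = upper (upper v)" "lower r = lower v"
      by (simp_all add: r_def upper_def lower_def)
    have "v \<bullet> ((E ** Qa ** transpose E) *v v) = (transpose E *v v) \<bullet> (Qa *v (transpose E *v v))"
      by (simp add: matrix_vector_mul_assoc[symmetric] inner_commute flip: dot_lmul_matrix)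
    also have "\<dots> = lower v \<bullet> (Q *v lower v)"
      by (simp add: inner_sum_index Qa_def block_mult E_def lower_mult_aug_E)
    finally have "v \<bullet> (M *v v) = r \<bullet> ((lmi A B C D \<gamma> P + block 0 0 0 Q) *v r)"
      unfolding M_def matrix_vector_mult_add_rdistrib inner_add_right
        lmi_form[OF symPa] lmi_form[OF symP]
      by (simp add: inner_sum_index[of "upper v"] inner_sum_index[of r] r Pa_def aug_A_def
          aug_B_def aug_C_def block_mult vstack_mult hstack_mult
          upper_add)
    then show ?thesis using nsd by (simp add: neg_semidef_def)
  qed
  ultimately have "neg_semidef M" by (simp add: neg_semidef_def)
  then show "\<exists>\<gamma>'. ereal \<gamma> = ereal \<gamma>' \<and> 0 < \<gamma>' \<and> (\<exists>Pa\<in>Sym. \<exists>Qa\<in>Ka. neg_semidef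
      (lmi (aug_A A Ap) (aug_B B Bp) (aug_C C) D \<gamma>' Pa + aug_E ** Qa ** transpose aug_E))"
    using \<gamma> symPa Qa unfolding M_def E_def by blast
qed

lemma block_lower_COP:
  "Q \<in> COP \<Longrightarrow> (block 0 0 0 Q :: real^('a::finite + 'b::finite)^('a + 'b)) \<in> COP"
  unfolding COP_def
proof safe
  assume "Q \<in> Sym" then show "block 0 0 0 Q \<in> Sym"
    by (simp add: Sym_def transpose_block transpose_zero)
next
  fix x :: "real^('a + 'b)"
  assume "\<forall>x. (\<forall>i. 0 \<le> x $ i) \<longrightarrow> 0 \<le> x \<bullet> (Q *v x)" "\<forall>i. 0 \<le> x $ i"
  then have "0 \<le> lower x \<bullet> (Q *v lower x)" by (simp add: lower_def)
  then show "0 \<le> x \<bullet> (block 0 0 0 Q *v x)" by (simp add: inner_sum_index block_mult)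
qed

lemma block_lower_PSD_plus_NN: 
  fixes Q :: "real^'w^'w"
  assumes "Q \<in> PSD + NN" 
  shows "(block 0 0 0 Q :: real^('p::finite + 'w)^('p + 'w)) \<in> PSD + NN"
proof -
  obtain R S where Q: "Q = R + S" and R: "R \<in> PSD" and S: "S \<in> NN"
    using assms by (auto elim: set_plus_elim)
  have "(block 0 0 0 R :: real^('p + 'w)^('p + 'w)) \<in> PSD"
    using R by (auto simp: PSD_def Sym_def transpose_block transpose_zero inner_sum_index block_mult)
  moreover have "(block 0 0 0 S :: real^('p + 'w)^('p + 'w)) \<in> NN"
  proof -
    have "(block 0 0 0 S :: real^('p + 'w)^('p + 'w)) \<in> Sym"
      using S by (simp add: NN_def Sym_def transpose_block transpose_zero)
    moreover have "entrywise_nonneg (block 0 0 0 S :: real^('p + 'w)^('p + 'w))"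
      using S by (simp add: NN_def entrywise_nonneg_def block_def vstack_def hstack_def split: sum.split)
    ultimately show ?thesis by (simp add: NN_def)
  qed
  moreover have "block 0 0 0 Q = block 0 0 0 R + (block 0 0 0 S :: real^('p + 'w)^('p + 'w))"
    by (simp add: Q block_def vstack_def hstack_def vec_eq_iff split: sum.split)
  ultimately show ?thesis by (metis set_plus_intro)
qed

lemma zero_COP: "0 \<in> COP"
  by (simp add: COP_def Sym_def transpose_zero)

lemma zero_PSD_plus_NN: "0 \<in> PSD + (NN :: (real^'n^'n) set)"
proof -
  have "(0 :: real^'n^'n) \<in> PSD" "(0 :: real^'n^'n) \<in> NN"
    by (simp_all add: PSD_def NN_def Sym_def transpose_zero entrywise_nonneg_def)
  then show ?thesis using set_plus_intro by force
qed

lemma COP_subset_Sym: "COP \<subseteq> Sym"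
  by (auto simp: COP_def)

lemma PSD_plus_NN_subset_Sym: "PSD + NN \<subseteq> Sym"
  by (auto simp: PSD_def NN_def Sym_add elim!: set_plus_elim)

section \<open>Linear differential equations with constant input\<close>

text \<open>The exponential series \<open>\<Sum>k. t^k / k! f^k v\<close>, differentiated coordinate by coordinate with the
  theorem on real power series.\<close>

lemma linear_flow_exists:
  fixes f :: "'a::euclidean_space \<Rightarrow> 'a"
  assumes f: "linear f"
  obtains y where "y 0 = v" "\<And>t. (y has_vector_derivative f (y t)) (at t)"
proof -
  have bl: "bounded_linear f" using f by (simp add: linear_conv_bounded_linear)
  obtain K where K: "K > 0" "\<And>x. norm (f x) \<le> norm x * K"
    using bounded_linear.pos_bounded[OF bl] by blast
  have pow: "norm ((f ^^ k) w) \<le> norm w * K ^ k" for k w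
  proof (induction k)
    case (Suc k)
    have "norm (f ((f ^^ k) w)) \<le> norm ((f ^^ k) w) * K" by (rule K)
    also have "\<dots> \<le> (norm w * K ^ k) * K" using Suc K(1) by (intro mult_right_mono) auto
    finally show ?case by (simp add: mult_ac)
  qed simp
  define y where "y t = (\<Sum>k. (t ^ k / fact k) *\<^sub>R (f ^^ k) v)" for t
  have y_sums: "(\<lambda>k. (t ^ k / fact k) *\<^sub>R (f ^^ k) v) sums y t" for t
  proof -
    have "summable (\<lambda>k. norm v * (inverse (fact k) * (\<bar>t\<bar> * K) ^ k))"
      by (intro summable_mult summable_exp)
    moreover have "norm ((t ^ k / fact k) *\<^sub>R (f ^^ k) v)
                     \<le> norm v * (inverse (fact k) * (\<bar>t\<bar> * K) ^ k)" for k
    proof -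
      have "\<bar>t\<bar> ^ k / fact k * norm ((f ^^ k) v) \<le> \<bar>t\<bar> ^ k / fact k * (norm v * K ^ k)"
        by (intro mult_left_mono pow) simp
      moreover have "norm ((t ^ k / fact k) *\<^sub>R (f ^^ k) v) = \<bar>t\<bar> ^ k / fact k * norm ((f ^^ k) v)"
        unfolding norm_scaleR by (simp only: real_norm_def abs_divide power_abs abs_of_nonneg[OF fact_ge_zero])
      ultimately have "norm ((t ^ k / fact k) *\<^sub>R (f ^^ k) v) \<le> \<bar>t\<bar> ^ k / fact k * (norm v * K ^ k)"
        by (simp only:)
      then show ?thesis by (simp only: power_mult_distrib divide_inverse mult_ac)
    qed
    ultimately have "summable (\<lambda>k. (t ^ k / fact k) *\<^sub>R (f ^^ k) v)"
      by (rule summable_comparison_test'[where N = 0])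
    then show ?thesis unfolding y_def by (rule summable_sums)
  qed
  have "y 0 = v"
  proof -
    have "(\<lambda>k. (0 ^ k / fact k) *\<^sub>R (f ^^ k) v) sums ((0 ^ 0 / fact 0) *\<^sub>R (f ^^ 0) v)"
      using sums_finite[of "{0}" "\<lambda>k. (0 ^ k / fact k) *\<^sub>R (f ^^ k) v"] by simp
    then show ?thesis using y_sums[of 0] sums_unique2 by fastforce
  qed
  moreover have "(y has_vector_derivative f (y t)) (at t)" for t
    unfolding has_vector_derivative_def
  proof (subst has_derivative_componentwise_within, intro ballI)
    fix b :: 'a assume "b \<in> Basis"
    define c where "c k = ((f ^^ k) v \<bullet> b) / fact k" for k
    have c_sums: "(\<lambda>k. c k * s ^ k) sums (y s \<bullet> b)" for s
      using bounded_linear.sums[OF bounded_linear_inner_left[of b] y_sums[of s]]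
      by (simp add: c_def mult_ac)
    have "(\<lambda>k. ((t ^ k / fact k) *\<^sub>R f ((f ^^ k) v)) \<bullet> b) sums (f (y t) \<bullet> b)"
      using bounded_linear.sums[OF bounded_linear_inner_left[of b] bounded_linear.sums[OF bl y_sums[of t]]]
      by (simp add: linear_cmul[OF f])
    moreover have "((t ^ k / fact k) *\<^sub>R f ((f ^^ k) v)) \<bullet> b = diffs c k * t ^ k" for k
      by (simp add: diffs_def c_def field_simps del: of_nat_Suc)
    ultimately have d_sums: "(\<lambda>k. diffs c k * t ^ k) sums (f (y t) \<bullet> b)" by simp
    have "((\<lambda>s. \<Sum>k. c k * s ^ k) has_field_derivative (\<Sum>k. diffs c k * t ^ k)) (at t)"
      by (rule termdiffs_strong_converges_everywhere) (use c_sums sums_summable in blast)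
    then have "((\<lambda>s. y s \<bullet> b) has_field_derivative (f (y t) \<bullet> b)) (at t)"
      using c_sums d_sums by (simp add: sums_iff)
    then show "((\<lambda>s. y s \<bullet> b) has_derivative (\<lambda>h. (h *\<^sub>R f (y t)) \<bullet> b)) (at t)"
      by (simp add: has_field_derivative_def mult_commute_abs)
  qed
  ultimately show ?thesis using that by blast
qed

text \<open>A constant input becomes part of the state: \<open>(x, u) \<mapsto> (A x + B u, 0)\<close> is linear, and its flow
  keeps the second component at its initial value.\<close>

lemma constant_input_response_exists:
  fixes A :: "real^'n^'n" and B :: "real^'w^'n"
  obtains y where "y 0 = x0" "\<And>t. (y has_vector_derivative (A *v y t + B *v u)) (at t)"
proof -
  define f :: "(real^'n) \<times> (real^'w) \<Rightarrow> (real^'n) \<times> (real^'w)"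
    where "f = (\<lambda>(x, u). (A *v x + B *v u, 0))"
  have "linear f"
    by (rule linearI)
      (auto simp: f_def matrix_vector_right_distrib matrix_vector_mult_scaleR scaleR_add_right)
  then obtain p where p: "p 0 = (x0, u)" "\<And>t. (p has_vector_derivative f (p t)) (at t)"
    using linear_flow_exists by blast
  have fst_p: "((\<lambda>s. fst (p s)) has_vector_derivative fst (f (p t))) (at t)" for t
    using bounded_linear.has_vector_derivative[OF bounded_linear_fst p(2)] .
  have "((\<lambda>s. snd (p s)) has_vector_derivative snd (f (p t))) (at t)" for t
    using bounded_linear.has_vector_derivative[OF bounded_linear_snd p(2)] .
  then have "((\<lambda>s. snd (p s)) has_vector_derivative 0) (at t)" for t
    by (simp add: f_def case_prod_beta)
  then have "snd (p t) = u" for t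
    using p(1) has_vector_derivative_zero_constant[of UNIV "\<lambda>s. snd (p s)"]
    by (metis UNIV_I convex_UNIV snd_conv)
  then have "fst (f (p t)) = A *v fst (p t) + B *v u" for t
    by (simp add: f_def case_prod_beta)
  with fst_p show ?thesis using that[of "\<lambda>s. fst (p s)"] p(1) by simp
qed

section \<open>Square-integrable signals on bounded intervals\<close>

text \<open>Square integrability with respect to the Henstock-Kurzweil integral. Integrability of \<open>f\<close> itself
  is included because it yields measurability; both conditions are stable under translation and
  gluing of intervals.\<close>

definition L2_on :: "(real \<Rightarrow> 'a::euclidean_space) \<Rightarrow> real set \<Rightarrow> bool" where
  "L2_on f S \<longleftrightarrow> f integrable_on S \<and> (\<lambda>s. (norm (f s))\<^sup>2) integrable_on S"

lemma L2_on_cong: "(\<And>s. s \<in> S \<Longrightarrow> f s = g s) \<Longrightarrow> L2_on f S \<longleftrightarrow> L2_on g S"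
  unfolding L2_on_def by (metis (mono_tags, lifting) integrable_cong)

lemma norm_parallelogram:
  "(norm (a + b))\<^sup>2 + (norm (a - b))\<^sup>2 = 2 * (norm a)\<^sup>2 + 2 * (norm b)\<^sup>2" for a b :: "'a::real_inner"
  by (simp add: power2_norm_eq_inner inner_add_left inner_add_right inner_diff_left inner_diff_right)

lemma norm_add_sq_le: "(norm (a + b))\<^sup>2 \<le> 2 * (norm a)\<^sup>2 + 2 * (norm b)\<^sup>2"
  for a b :: "'a::real_inner"
  using norm_parallelogram[of a b] zero_le_power2[of "norm (a - b)"] by linarith

lemma L2_onI_bound:
  fixes f :: "real \<Rightarrow> 'a::euclidean_space"
  assumes f: "f integrable_on {a..b}" and g: "g integrable_on {a..b}"
    and le: "\<And>s. s \<in> {a..b} \<Longrightarrow> (norm (f s))\<^sup>2 \<le> g s"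
  shows "L2_on f {a..b}"
  unfolding L2_on_def
proof (intro conjI f measurable_bounded_by_integrable_imp_integrable_real[OF _ g])
  show "(\<lambda>s. (norm (f s))\<^sup>2) \<in> borel_measurable (lebesgue_on {a..b})"
    using integrable_imp_measurable[OF f] by measurable
qed (use le in auto)

lemma L2_on_add:
  fixes f g :: "real \<Rightarrow> 'a::euclidean_space"
  assumes "L2_on f {a..b}" "L2_on g {a..b}"
  shows "L2_on (\<lambda>s. f s + g s) {a..b}"
proof (rule L2_onI_bound)
  show "(\<lambda>s. 2 * (norm (f s))\<^sup>2 + 2 * (norm (g s))\<^sup>2) integrable_on {a..b}"
    using assms by (intro integrable_add integrable_on_mult_right) (auto simp: L2_on_def)
qed (use assms in \<open>auto simp: L2_on_def norm_add_sq_le intro: integrable_add\<close>)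

lemma L2_on_bounded_linear:
  fixes f :: "real \<Rightarrow> 'a::euclidean_space" and h :: "'a \<Rightarrow> 'b::euclidean_space"
  assumes f: "L2_on f {a..b}" and h: "bounded_linear h"
  shows "L2_on (\<lambda>s. h (f s)) {a..b}"
proof -
  obtain K where K: "\<And>x. norm (h x) \<le> norm x * K"
    using bounded_linear.bounded[OF h] by blast
  have "(\<lambda>s. K\<^sup>2 * (norm (f s))\<^sup>2) integrable_on {a..b}"
    using f by (intro integrable_on_mult_right) (simp add: L2_on_def)
  moreover have "(norm (h x))\<^sup>2 \<le> K\<^sup>2 * (norm x)\<^sup>2" for x
    using power_mono[OF K[of x], of 2] by (simp add: power_mult_distrib mult.commute)
  moreover have "(\<lambda>s. h (f s)) integrable_on {a..b}"
    using f h integrable_linear[of f _ h] by (auto simp: L2_on_def o_def)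
  ultimately show ?thesis by (intro L2_onI_bound)
qed

lemma L2_on_continuous:
  fixes f :: "real \<Rightarrow> 'a::euclidean_space"
  assumes "continuous_on {a..b} f"
  shows "L2_on f {a..b}"
  unfolding L2_on_def using assms by (intro conjI integrable_continuous_real continuous_intros)

text \<open>At the junction itself the first signal is used, so that a concatenated trajectory keeps its
  value at time \<open>T\<close>; for inputs the value at a single time is irrelevant.\<close>

definition concat_at :: "real \<Rightarrow> (real \<Rightarrow> 'a) \<Rightarrow> (real \<Rightarrow> 'a) \<Rightarrow> real \<Rightarrow> 'a" where
  "concat_at T f g s = (if s \<le> T then f s else g (s - T))"

lemma concat_at_before [simp]: "s \<le> T \<Longrightarrow> concat_at T f g s = f s"
  and concat_at_after [simp]: "T < s \<Longrightarrow> concat_at T f g s = g (s - T)"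
  by (simp_all add: concat_at_def)

lemma concat_at_distrib:
  "h (concat_at T f g s) (concat_at T f' g' s) = concat_at T (\<lambda>s. h (f s) (f' s)) (\<lambda>s. h (g s) (g' s)) s"
  by (simp add: concat_at_def)

lemma has_integral_concat:
  fixes f g :: "real \<Rightarrow> 'a::banach"
  assumes f: "(f has_integral i) {0..T}" and g: "(g has_integral j) {0..S}" and "0 \<le> T" "0 \<le> S"
  shows "(concat_at T f g has_integral (i + j)) {0..T + S}"
proof (rule has_integral_combine[of _ T])
  show "(concat_at T f g has_integral i) {0..T}"
    by (rule has_integral_eq[OF _ f]) simp
  have "((\<lambda>s. g (s - T)) has_integral j) {T..T + S}"
    using has_integral_shift_real_ivl[OF g, of "- T"] by (simp add: add.commute)
  then show "(concat_at T f g has_integral j) {T..T + S}"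
    by (rule has_integral_spike_finite[of "{T}", rotated -1]) auto
qed (use assms in auto)

lemma L2_on_concat:
  fixes f g :: "real \<Rightarrow> 'a::euclidean_space"
  assumes f: "L2_on f {0..T}" and g: "L2_on g {0..S}" and "0 \<le> T" "0 \<le> S"
  shows "L2_on (concat_at T f g) {0..T + S}"
proof -
  have integrable: "concat_at T p q integrable_on {0..T + S}"
    if "p integrable_on {0..T}" "q integrable_on {0..S}" for p q :: "real \<Rightarrow> 'b::banach"
    using that has_integral_concat[of p _ T q _ S] assms(3,4)
    unfolding integrable_on_def by blast
  have "concat_at T (\<lambda>s. (norm (f s))\<^sup>2) (\<lambda>s. (norm (g s))\<^sup>2) integrable_on {0..T + S}"
    using f g by (intro integrable) (auto simp: L2_on_def)
  moreover have "concat_at T f g integrable_on {0..T + S}"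
    using f g by (intro integrable) (auto simp: L2_on_def)
  moreover have "(\<lambda>s. (norm (concat_at T f g s))\<^sup>2) = concat_at T (\<lambda>s. (norm (f s))\<^sup>2) (\<lambda>s. (norm (g s))\<^sup>2)"
    by (simp add: concat_at_def fun_eq_iff)
  ultimately show ?thesis by (simp add: L2_on_def)
qed


section \<open>Trajectories on bounded intervals\<close>

text \<open>A trajectory of finite length \<open>T\<close> from \<open>x0\<close>. In contrast to \<open>state_trajectory\<close> the equation is only
  required up to time \<open>T\<close>, so that trajectories can be prolonged and delayed.\<close>

definition arc ::
  "real^'n^'n \<Rightarrow> real^'w^'n \<Rightarrow> real \<Rightarrow> real^'n \<Rightarrow> (real \<Rightarrow> real^'w) \<Rightarrow> (real \<Rightarrow> real^'n) \<Rightarrow> bool" where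
  "arc A B T x0 w x \<longleftrightarrow> 0 \<le> T \<and> L2_on w {0..T} \<and>
     (\<forall>t\<in>{0..T}. ((\<lambda>s. A *v x s + B *v w s) has_integral (x t - x0)) {0..t})"

lemma arc_nonneg: "arc A B T x0 w x \<Longrightarrow> 0 \<le> T"
  by (simp add: arc_def)

lemma arc_initial: "arc A B T x0 w x \<Longrightarrow> x 0 = x0"
proof -
  assume "arc A B T x0 w x"
  then have "((\<lambda>s. A *v x s + B *v w s) has_integral (x 0 - x0)) {0..0}"
    by (auto simp only: arc_def atLeastAtMost_iff)
  moreover have "((\<lambda>s. A *v x s + B *v w s) has_integral 0) {0..0::real}" by auto
  ultimately have "x 0 - x0 = 0" by (rule has_integral_unique)
  then show "x 0 = x0" by simp
qed

lemma arc_continuous: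
  assumes "arc A B T x0 w x"
  shows "continuous_on {0..T} x"
proof -
  let ?f = "\<lambda>s. A *v x s + B *v w s"
  have int: "(?f has_integral (x t - x0)) {0..t}" if "t \<in> {0..T}" for t
    using assms that by (simp add: arc_def)
  have "?f integrable_on {0..T}" using int[of T] arc_nonneg[OF assms] by auto
  then have "continuous_on {0..T} (\<lambda>t. x0 + integral {0..t} ?f)"
    by (intro continuous_intros indefinite_integral_continuous_1)
  moreover have "x0 + integral {0..t} ?f = x t" if "t \<in> {0..T}" for t
    using integral_unique[OF int[OF that]] by simp
  ultimately show ?thesis by (rule continuous_on_eq)
qed

text \<open>The state is an indefinite integral, hence continuous, so only the input contributes a
  possibly unbounded term to the output.\<close>

lemma arc_output_L2:
  assumes "arc A B T x0 w x"
  shows "L2_on (\<lambda>s. C *v x s + D *v w s) {0..T}"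
proof (rule L2_on_add)
  show "L2_on (\<lambda>s. C *v x s) {0..T}"
    by (rule L2_on_bounded_linear[OF L2_on_continuous[OF arc_continuous[OF assms]]]) simp
  show "L2_on (\<lambda>s. D *v w s) {0..T}"
    using assms L2_on_bounded_linear[of w 0 T "(*v) D"] by (simp add: arc_def)
qed

lemma arc_add:
  assumes "arc A B T x0 w x" "arc A B T y0 v y"
  shows "arc A B T (x0 + y0) (\<lambda>s. w s + v s) (\<lambda>s. x s + y s)"
  unfolding arc_def
proof (intro conjI ballI)
  show "L2_on (\<lambda>s. w s + v s) {0..T}" using assms by (intro L2_on_add) (auto simp: arc_def)
  fix t assume "t \<in> {0..T}"
  then have "((\<lambda>s. (A *v x s + B *v w s) + (A *v y s + B *v v s)) has_integral
      (x t - x0) + (y t - y0)) {0..t}"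
    using assms by (intro has_integral_add) (auto simp: arc_def)
  then show "((\<lambda>s. A *v (x s + y s) + B *v (w s + v s)) has_integral x t + y t - (x0 + y0)) {0..t}"
    by (simp add: matrix_vector_right_distrib algebra_simps)
qed (use arc_nonneg[OF assms(1)] in simp)

lemma arc_scaleR:
  assumes "arc A B T x0 w x"
  shows "arc A B T (c *\<^sub>R x0) (\<lambda>s. c *\<^sub>R w s) (\<lambda>s. c *\<^sub>R x s)"
  unfolding arc_def
proof (intro conjI ballI)
  show "L2_on (\<lambda>s. c *\<^sub>R w s) {0..T}"
    using assms L2_on_bounded_linear[OF _ bounded_linear_scaleR_right, of w 0 T c]
    by (simp add: arc_def)
  fix t assume "t \<in> {0..T}"
  then have "((\<lambda>s. c *\<^sub>R (A *v x s + B *v w s)) has_integral c *\<^sub>R (x t - x0)) {0..t}"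
    using assms by (intro has_integral_cmul) (simp add: arc_def)
  then show "((\<lambda>s. A *v (c *\<^sub>R x s) + B *v (c *\<^sub>R w s)) has_integral c *\<^sub>R x t - c *\<^sub>R x0) {0..t}"
    by (simp add: matrix_vector_mult_scaleR scaleR_add_right scaleR_diff_right)
qed (use arc_nonneg[OF assms] in simp)

lemma arc_diff:
  assumes "arc A B T x0 w x" "arc A B T y0 v y"
  shows "arc A B T (x0 - y0) (\<lambda>s. w s - v s) (\<lambda>s. x s - y s)"
  using arc_add[OF assms(1) arc_scaleR[OF assms(2), of "-1"]] by simp

lemma arc_zero: "0 \<le> T \<Longrightarrow> arc A B T 0 (\<lambda>_. 0) (\<lambda>_. 0)"
  by (simp add: arc_def L2_on_continuous)

lemma arc_concat:
  assumes xw: "arc A B T x0 w x" and yv: "arc A B S (x T) v y"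
  shows "arc A B (T + S) x0 (concat_at T w v) (concat_at T x y)"
  unfolding arc_def
proof (intro conjI ballI)
  have TS: "0 \<le> T" "0 \<le> S" using assms by (auto simp: arc_def)
  then show "0 \<le> T + S" by simp
  show "L2_on (concat_at T w v) {0..T + S}"
    using assms by (intro L2_on_concat) (auto simp: arc_def)
  fix t assume t: "t \<in> {0..T + S}"
  show "((\<lambda>s. A *v concat_at T x y s + B *v concat_at T w v s) has_integral
      (concat_at T x y t - x0)) {0..t}"
  proof (cases "t \<le> T")
    case True
    then have "((\<lambda>s. A *v x s + B *v w s) has_integral (x t - x0)) {0..t}"
      using xw t by (simp add: arc_def)
    then have "((\<lambda>s. A *v concat_at T x y s + B *v concat_at T w v s) has_integral (x t - x0)) {0..t}"
      by (rule has_integral_eq[rotated]) (use True in auto)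
    then show ?thesis using True by simp
  next
    case False
    have "(concat_at T (\<lambda>s. A *v x s + B *v w s) (\<lambda>s. A *v y s + B *v v s) has_integral
        (x T - x0) + (y (t - T) - x T)) {0..T + (t - T)}"
      using assms t False TS by (intro has_integral_concat) (auto simp: arc_def)
    then have "(concat_at T (\<lambda>s. A *v x s + B *v w s) (\<lambda>s. A *v y s + B *v v s) has_integral
        concat_at T x y t - x0) {0..t}" using False by simp
    then show ?thesis
      by (simp only: concat_at_distrib[of "\<lambda>x w. A *v x + B *v w"])
  qed
qed

lemma arc_constant_input:
  assumes y: "y 0 = x0" "\<And>t. (y has_vector_derivative (A *v y t + B *v u)) (at t)" and T: "0 \<le> T"
  shows "arc A B T x0 (\<lambda>_. u) y"
  unfolding arc_def
proof (intro conjI ballI T)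
  show "L2_on (\<lambda>_. u) {0..T}" by (simp add: L2_on_continuous)
  fix t assume "t \<in> {0..T}"
  then show "((\<lambda>s. A *v y s + B *v u) has_integral (y t - x0)) {0..t}"
    using y(2) unfolding y(1)[symmetric]
    by (intro fundamental_theorem_of_calculus) (auto intro: has_vector_derivative_at_within)
qed

section \<open>The gain bound on trajectories of finite length\<close>

text \<open>The definition of \<open>l2_norm\<close> integrates energies in the sense of Lebesgue, trajectories are
  governed by gauge integrals; for nonnegative functions both integrals agree.\<close>

lemma has_integral_sq_halfline:
  fixes f :: "real \<Rightarrow> 'a::euclidean_space"
  shows "((\<lambda>t. (norm (f t))\<^sup>2) has_integral r) {0..} \<longleftrightarrow>
    (\<lambda>t. (norm (f t))\<^sup>2) \<in> borel_measurable (lebesgue_on {0..}) \<and>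
    (\<integral>\<^sup>+ t. ennreal ((norm (f t))\<^sup>2) \<partial>lebesgue_on {0..}) = ennreal r \<and> 0 \<le> r"
proof -
  let ?g = "\<lambda>t. if t \<in> {0..} then (norm (f t))\<^sup>2 else 0"
  have "(\<integral>\<^sup>+ t. ennreal (?g t) \<partial>lebesgue) = (\<integral>\<^sup>+ t. ennreal ((norm (f t))\<^sup>2) \<partial>lebesgue_on {0..})"
    by (subst nn_integral_restrict_space) (auto intro!: nn_integral_cong simp: indicator_def)
  moreover have "?g \<in> borel_measurable lebesgue \<longleftrightarrow> (\<lambda>t. (norm (f t))\<^sup>2) \<in> borel_measurable (lebesgue_on {0..})"
    by (rule borel_measurable_if) simp
  ultimately show ?thesis
    using has_integral_iff_nn_integral_lebesgue[of ?g r]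
    unfolding has_integral_restrict_UNIV by simp
qed

lemma l2_norm_eq_sqrt_integral:
  assumes "((\<lambda>t. (norm (f t))\<^sup>2) has_integral r) {0..}"
  shows "l2_norm f = ereal (sqrt r)"
  using assms unfolding has_integral_sq_halfline by (simp add: l2_norm_def Let_def)

text \<open>On a bounded interval square integrability implies integrability, since \<open>|w| \<le> 1 + |w|\<^sup>2\<close>.\<close>

lemma L2_imp_L2_on:
  fixes w :: "real \<Rightarrow> 'a::euclidean_space"
  assumes "w \<in> L2"
  shows "L2_on w {0..T}"
proof -
  have meas: "w \<in> borel_measurable (lebesgue_on {0..})" and fin: "l2_norm w < \<infinity>"
    using assms by (auto simp: L2_def)
  have "(\<integral>\<^sup>+ t. ennreal ((norm (w t))\<^sup>2) \<partial>lebesgue_on {0..}) \<noteq> \<infinity>"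
    using fin by (auto simp: l2_norm_def Let_def split: if_splits)
  then obtain r where "(\<integral>\<^sup>+ t. ennreal ((norm (w t))\<^sup>2) \<partial>lebesgue_on {0..}) = ennreal r" "0 \<le> r"
    by (metis ennreal_cases infinity_ennreal_def)
  moreover have "(\<lambda>t. (norm (w t))\<^sup>2) \<in> borel_measurable (lebesgue_on {0..})"
    using meas by measurable
  ultimately have "((\<lambda>t. (norm (w t))\<^sup>2) has_integral r) {0..}"
    by (simp add: has_integral_sq_halfline)
  then have sq: "(\<lambda>t. (norm (w t))\<^sup>2) integrable_on {0..T}"
    using integrable_on_subinterval[of _ "{0..}" 0 T] by auto
  have "w integrable_on {0..T}"
  proof (rule measurable_bounded_by_integrable_imp_integrable)
    show "w \<in> borel_measurable (lebesgue_on {0..T})"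
      by (rule measurable_restrict_mono[OF meas]) auto
    show "(\<lambda>t. 1 + (norm (w t))\<^sup>2) integrable_on {0..T}"
      using sq by (intro integrable_add) auto
    show "norm (w t) \<le> 1 + (norm (w t))\<^sup>2" for t
    proof -
      have "2 * norm (w t) \<le> (norm (w t))\<^sup>2 + 1"
        using zero_le_power2[of "norm (w t) - 1"] by (simp add: power2_diff)
      then show ?thesis using norm_ge_zero[of "w t"] by linarith
    qed
  qed simp
  with sq show ?thesis by (simp add: L2_on_def)
qed

text \<open>The energy on a bounded interval is part of the energy on \<open>[0,\<infinity>)\<close>, and the latter is finite
  because \<open>l2_norm z\<close> has a real bound.\<close>

lemma integral_sq_le_l2_norm:
  fixes z :: "real \<Rightarrow> 'a::euclidean_space"
  assumes z: "L2_on z {0..T}" and le: "l2_norm z \<le> ereal g" and "0 \<le> g"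
  shows "integral {0..T} (\<lambda>t. (norm (z t))\<^sup>2) \<le> g\<^sup>2"
proof -
  define I where "I = (\<integral>\<^sup>+ t. ennreal ((norm (z t))\<^sup>2) \<partial>lebesgue_on {0..})"
  let ?r = "integral {0..T} (\<lambda>t. (norm (z t))\<^sup>2)"
  have "((\<lambda>t. if t \<in> {0..T} then (norm (z t))\<^sup>2 else 0) has_integral ?r) UNIV"
    using z unfolding has_integral_restrict_UNIV by (simp add: L2_on_def integrable_integral)
  then have r: "ennreal ?r = (\<integral>\<^sup>+ t. ennreal (if t \<in> {0..T} then (norm (z t))\<^sup>2 else 0) \<partial>lebesgue)" "0 \<le> ?r"
    by (subst (asm) has_integral_iff_nn_integral_lebesgue; simp)+
  have "ennreal ?r = (\<integral>\<^sup>+ t. ennreal (if t \<in> {0..T} then (norm (z t))\<^sup>2 else 0) \<partial>lebesgue)"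
    by (rule r(1))
  also have "\<dots> \<le> (\<integral>\<^sup>+ t. ennreal ((norm (z t))\<^sup>2) * indicator {0..} t \<partial>lebesgue)"
    by (intro nn_integral_mono) (auto simp: indicator_def)
  also have "\<dots> = I" unfolding I_def by (subst nn_integral_restrict_space) auto
  finally have rI: "ennreal ?r \<le> I" .
  have "I \<noteq> \<infinity>" using le by (auto simp: l2_norm_def Let_def I_def[symmetric] split: if_splits)
  then have "sqrt (enn2real I) \<le> g"
    using le by (simp add: l2_norm_def Let_def I_def[symmetric] split: if_splits)
  then have "enn2real I \<le> g\<^sup>2" using \<open>0 \<le> g\<close> by (simp add: sqrt_le_D)
  moreover have "?r \<le> enn2real I"
    using enn2real_mono[OF rI] r(2) \<open>I \<noteq> \<infinity>\<close> by (simp add: less_top)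
  ultimately show ?thesis by simp
qed

lemma integral_norm_add_sq_le:
  fixes f g :: "real \<Rightarrow> 'a::euclidean_space"
  assumes "L2_on f {a..b}" "L2_on g {a..b}"
  shows "integral {a..b} (\<lambda>s. (norm (f s + g s))\<^sup>2)
    \<le> 2 * integral {a..b} (\<lambda>s. (norm (f s))\<^sup>2) + 2 * integral {a..b} (\<lambda>s. (norm (g s))\<^sup>2)"
proof -
  have "integral {a..b} (\<lambda>s. (norm (f s + g s))\<^sup>2)
      \<le> integral {a..b} (\<lambda>s. 2 * (norm (f s))\<^sup>2 + 2 * (norm (g s))\<^sup>2)"
    using assms L2_on_add[OF assms]
    by (intro integral_le norm_add_sq_le integrable_add integrable_on_mult_right) (auto simp: L2_on_def)
  also have "\<dots> = 2 * integral {a..b} (\<lambda>s. (norm (f s))\<^sup>2) + 2 * integral {a..b} (\<lambda>s. (norm (g s))\<^sup>2)"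
    using assms by (subst integral_add) (auto simp: L2_on_def intro: integrable_on_mult_right)
  finally show ?thesis .
qed

text \<open>Switching the input off after time \<open>T\<close> turns a finite trajectory into one on \<open>[0,\<infinity>)\<close> whose input
  has the same energy. This connects finite trajectories with the induced norm.\<close>

lemma arc_extension:
  fixes A :: "real^'n^'n" and B :: "real^'w^'n"
  assumes xw: "arc A B T 0 w x"
  obtains W X where "W \<in> L2" "l2_norm W = ereal (sqrt (integral {0..T} (\<lambda>s. (norm (w s))\<^sup>2)))"
    "state_trajectory A B 0 W X" "\<forall>s\<le>T. W s = w s \<and> X s = x s"
proof -
  have T: "0 \<le> T" and w: "L2_on w {0..T}" using xw by (auto simp: arc_def)
  \<comment> \<open>the free response from the state reached at time \<open>T\<close>\<close>
  obtain y where y: "y 0 = x T" "\<And>t. (y has_vector_derivative (A *v y t + B *v 0)) (at t)"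
    using constant_input_response_exists[where A = A and B = B and u = 0 and ?x0.0 = "x T"] by metis
  define W where "W = concat_at T w (\<lambda>_. 0)"
  define X where "X = concat_at T x y"
  have "arc A B (T + t) 0 W X" if "0 \<le> t" for t
    unfolding W_def X_def using arc_concat[OF xw arc_constant_input[OF y that]] .
  then have "((\<lambda>s. A *v X s + B *v W s) has_integral (X t - 0)) {0..t}" if "0 \<le> t" for t
    using that T by (simp add: arc_def)
  then have traj: "state_trajectory A B 0 W X" by (simp add: state_trajectory_def)
  have "((\<lambda>s. if s \<in> {0..T} then w s else 0) has_integral integral {0..T} w) {0..}"
    using w by (subst has_integral_restrict) (auto simp: L2_on_def integrable_integral)
  then have "W integrable_on {0..}"
    by (rule integrable_eq[OF has_integral_integrable]) (auto simp: W_def concat_at_def)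
  then have meas: "W \<in> borel_measurable (lebesgue_on {0..})" by (rule integrable_imp_measurable)
  have "((\<lambda>s. if s \<in> {0..T} then (norm (w s))\<^sup>2 else 0) has_integral
      integral {0..T} (\<lambda>s. (norm (w s))\<^sup>2)) {0..}"
    using w by (subst has_integral_restrict) (auto simp: L2_on_def integrable_integral)
  then have "((\<lambda>s. (norm (W s))\<^sup>2) has_integral integral {0..T} (\<lambda>s. (norm (w s))\<^sup>2)) {0..}"
    by (rule has_integral_eq[rotated]) (auto simp: W_def concat_at_def)
  then have "l2_norm W = ereal (sqrt (integral {0..T} (\<lambda>s. (norm (w s))\<^sup>2)))"
    by (rule l2_norm_eq_sqrt_integral)
  moreover from this meas have "W \<in> L2" by (simp add: L2_def)
  ultimately show ?thesis using that traj by (simp add: W_def X_def)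
qed

lemma unit_arc_output_bound:
  fixes A :: "real^'n^'n" and B :: "real^'w^'n" and C :: "real^'n^'z" and D :: "real^'w^'z"
  assumes gain: "L2_gain A B C D \<le> ereal g" and "0 \<le> g"
    and xw: "arc A B T 0 w x" and norm1: "integral {0..T} (\<lambda>s. (norm (w s))\<^sup>2) = 1"
  shows "integral {0..T} (\<lambda>s. (norm (C *v x s + D *v w s))\<^sup>2) \<le> g\<^sup>2"
proof -
  obtain W X where W: "W \<in> L2"
    and energy: "l2_norm W = ereal (sqrt (integral {0..T} (\<lambda>s. (norm (w s))\<^sup>2)))"
    and traj: "state_trajectory A B 0 W X"
    and agree: "\<forall>s\<le>T. W s = w s \<and> X s = x s"
    by (rule arc_extension[OF xw])
  have "l2_norm W = 1" using energy norm1 by (simp add: one_ereal_def)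
  have "l2_norm (\<lambda>t. C *v X t + D *v W t) \<le> L2_gain A B C D"
    unfolding L2_gain_def using W traj \<open>l2_norm W = 1\<close> by (intro Sup_upper) blast
  then have le: "l2_norm (\<lambda>t. C *v X t + D *v W t) \<le> ereal g" using gain by (rule order_trans)
  have cong: "C *v X s + D *v W s = C *v x s + D *v w s" if "s \<in> {0..T}" for s
    using that agree by simp
  have "L2_on (\<lambda>s. C *v X s + D *v W s) {0..T}"
    by (rule L2_on_cong[THEN iffD2, OF cong arc_output_L2[OF xw]])
  from integral_sq_le_l2_norm[OF this le \<open>0 \<le> g\<close>] show ?thesis
    using integral_cong[of "{0..T}" "\<lambda>s. (norm (C *v X s + D *v W s))\<^sup>2"
        "\<lambda>s. (norm (C *v x s + D *v w s))\<^sup>2"] cong by simp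
qed

text \<open>A supremum over the empty set would be \<open>-\<infinity>\<close>; the point is that a trajectory with an input of
  norm one exists, for instance a constant unit vector on \<open>[0,1]\<close>, switched off afterwards.\<close>

lemma L2_gain_nonneg:
  fixes A :: "real^'n^'n" and B :: "real^'w^'n" and C :: "real^'n^'z" and D :: "real^'w^'z"
  shows "0 \<le> L2_gain A B C D"
proof -
  \<comment> \<open>any unit vector serves\<close>
  define u :: "real^'w" where "u = axis undefined 1"
  obtain y where y: "y 0 = 0" "\<And>t. (y has_vector_derivative (A *v y t + B *v u)) (at t)"
    using constant_input_response_exists[where A = A and B = B and u = u and ?x0.0 = "0"] by metis
  have norm_u: "integral {0..1::real} (\<lambda>_. (norm u)\<^sup>2) = 1" by (simp add: u_def)
  obtain W X where WX: "W \<in> L2" "l2_norm W = 1" "state_trajectory A B 0 W X"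
    using arc_extension[OF arc_constant_input[OF y, of 1]] norm_u
    by (metis one_ereal_def real_sqrt_one zero_le_one)
  have "0 \<le> l2_norm (\<lambda>t. C *v X t + D *v W t)" by (simp add: l2_norm_def Let_def)
  also have "\<dots> \<le> L2_gain A B C D"
    unfolding L2_gain_def using WX by (intro Sup_upper) blast
  finally show ?thesis .
qed


section \<open>The supply rate\<close>

text \<open>The supply rate of dissipativity theory for the gain \<open>g\<close>: \<open>g\<^sup>2|w|\<^sup>2 - |z|\<^sup>2\<close>.\<close>

definition supply_rate :: "real^'n^'z \<Rightarrow> real^'w^'z \<Rightarrow> real \<Rightarrow> real^'w \<Rightarrow> real^'n \<Rightarrow> real" where
  "supply_rate C D g u x = g\<^sup>2 * (norm u)\<^sup>2 - (norm (C *v x + D *v u))\<^sup>2"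

definition total_supply ::
  "real^'n^'z \<Rightarrow> real^'w^'z \<Rightarrow> real \<Rightarrow> real \<Rightarrow> (real \<Rightarrow> real^'w) \<Rightarrow> (real \<Rightarrow> real^'n) \<Rightarrow> real" where
  "total_supply C D g T w x = integral {0..T} (\<lambda>s. supply_rate C D g (w s) (x s))"

lemma supply_rate_integrable:
  assumes "arc A B T x0 w x"
  shows "(\<lambda>s. supply_rate C D g (w s) (x s)) integrable_on {0..T}"
  unfolding supply_rate_def using assms arc_output_L2[OF assms, of C D]
  by (intro integrable_diff integrable_on_mult_right) (auto simp: L2_on_def arc_def)

lemma total_supply_eq:
  assumes "arc A B T x0 w x"
  shows "total_supply C D g T w x = g\<^sup>2 * integral {0..T} (\<lambda>s. (norm (w s))\<^sup>2)
    - integral {0..T} (\<lambda>s. (norm (C *v x s + D *v w s))\<^sup>2)"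
  unfolding supply_rate_def total_supply_def using assms arc_output_L2[OF assms, of C D]
  by (subst integral_diff) (auto simp: L2_on_def arc_def intro: integrable_on_mult_right)

lemma supply_rate_scaleR:
  "supply_rate C D g (c *\<^sub>R u) (c *\<^sub>R x) = c\<^sup>2 * supply_rate C D g u x"
proof -
  have "C *v (c *\<^sub>R x) + D *v (c *\<^sub>R u) = c *\<^sub>R (C *v x + D *v u)"
    by (simp add: matrix_vector_mult_scaleR scaleR_add_right)
  then show ?thesis
    unfolding supply_rate_def by (simp only: norm_scaleR power_mult_distrib power2_abs right_diff_distrib mult_ac)
qed

lemma total_supply_scaleR:
  "total_supply C D g T (\<lambda>s. c *\<^sub>R w s) (\<lambda>s. c *\<^sub>R x s) = c\<^sup>2 * total_supply C D g T w x"
  by (simp add: total_supply_def supply_rate_scaleR)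

lemma supply_rate_parallelogram:
  fixes C :: "real^'n^'z" and D :: "real^'w^'z"
  shows
  "supply_rate C D g (u + v) (x + y) + supply_rate C D g (u - v) (x - y) = 2 * supply_rate C D g u x + 2 * supply_rate C D g v y"
proof -
  have "C *v (x + y) + D *v (u + v) = (C *v x + D *v u) + (C *v y + D *v v)"
    "C *v (x - y) + D *v (u - v) = (C *v x + D *v u) - (C *v y + D *v v)"
    by (simp_all add: matrix_vector_right_distrib matrix_vector_mult_diff_distrib)
  then have "supply_rate C D g (u + v) (x + y) + supply_rate C D g (u - v) (x - y)
      = g\<^sup>2 * ((norm (u + v))\<^sup>2 + (norm (u - v))\<^sup>2)
        - ((norm ((C *v x + D *v u) + (C *v y + D *v v)))\<^sup>2 + (norm ((C *v x + D *v u) - (C *v y + D *v v)))\<^sup>2)"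
    by (simp add: supply_rate_def algebra_simps)
  then show ?thesis unfolding norm_parallelogram by (simp add: supply_rate_def algebra_simps)
qed

lemma total_supply_parallelogram:
  assumes "arc A B T x0 w x" "arc A B T y0 v y"
  shows "total_supply C D g T (\<lambda>s. w s + v s) (\<lambda>s. x s + y s)
      + total_supply C D g T (\<lambda>s. w s - v s) (\<lambda>s. x s - y s)
    = 2 * total_supply C D g T w x + 2 * total_supply C D g T v y"
proof -
  have "total_supply C D g T (\<lambda>s. w s + v s) (\<lambda>s. x s + y s)
      + total_supply C D g T (\<lambda>s. w s - v s) (\<lambda>s. x s - y s)
    = integral {0..T} (\<lambda>s. supply_rate C D g (w s + v s) (x s + y s) + supply_rate C D g (w s - v s) (x s - y s))"
    unfolding total_supply_def
    by (rule integral_add[symmetric])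
      (rule supply_rate_integrable[OF arc_add[OF assms]] supply_rate_integrable[OF arc_diff[OF assms]])+
  also have "\<dots> = 2 * total_supply C D g T w x + 2 * total_supply C D g T v y"
    unfolding supply_rate_parallelogram total_supply_def
    using supply_rate_integrable[OF assms(1)] supply_rate_integrable[OF assms(2)]
    by (subst integral_add) (auto intro: integrable_on_mult_right)
  finally show ?thesis .
qed

lemma total_supply_concat:
  assumes "arc A B T x0 w x" "arc A B S y0 v y"
  shows "total_supply C D g (T + S) (concat_at T w v) (concat_at T x y)
    = total_supply C D g T w x + total_supply C D g S v y"
  unfolding total_supply_def concat_at_distrib[of "supply_rate C D g"]
  using assms by (intro integral_unique has_integral_concat integrable_integral)
    (auto intro: supply_rate_integrable arc_nonneg)

text \<open>If the input has positive energy, scale it to energy one and use the gain bound. An input of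
  energy zero cannot be scaled; for it, add a large multiple of the trajectory to one with nonzero
  constant input. The sum has positive energy, so its supply is nonnegative, and this would fail
  for a large multiple if the supply of the given trajectory were negative.\<close>

lemma total_supply_nonneg:
  fixes A :: "real^'n^'n" and B :: "real^'w^'n" and C :: "real^'n^'z" and D :: "real^'w^'z"
  assumes gain: "L2_gain A B C D \<le> ereal g" and "0 \<le> g"
    and xw: "arc A B T 0 w x"
  shows "0 \<le> total_supply C D g T w x"
proof -
  have active: "0 \<le> total_supply C D g T v y"
    if yv: "arc A B T 0 v y" and pos: "integral {0..T} (\<lambda>s. (norm (v s))\<^sup>2) > 0" for v y
  proof -
    define N where "N = integral {0..T} (\<lambda>s. (norm (v s))\<^sup>2)"
    define c where "c = 1 / sqrt N"
    have c2: "c\<^sup>2 * N = 1" and c: "c\<^sup>2 > 0"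
      using pos by (auto simp: c_def N_def power_divide)
    have yv': "arc A B T 0 (\<lambda>s. c *\<^sub>R v s) (\<lambda>s. c *\<^sub>R y s)"
      using arc_scaleR[OF yv, of c] by simp
    have norm1: "integral {0..T} (\<lambda>s. (norm (c *\<^sub>R v s))\<^sup>2) = 1"
      using c2 by (simp add: power_mult_distrib N_def)
    have "0 \<le> total_supply C D g T (\<lambda>s. c *\<^sub>R v s) (\<lambda>s. c *\<^sub>R y s)"
      using unit_arc_output_bound[OF gain \<open>0 \<le> g\<close> yv' norm1] norm1
      by (simp add: total_supply_eq[OF yv'])
    then show ?thesis using c by (simp add: total_supply_scaleR zero_le_mult_iff)
  qed
  have T: "0 \<le> T" using xw by (rule arc_nonneg)
  show ?thesis
  proof (rule ccontr)
    assume neg: "\<not> 0 \<le> total_supply C D g T w x"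
    then have N0: "integral {0..T} (\<lambda>s. (norm (w s))\<^sup>2) = 0"
      using active[OF xw] integral_nonneg[of "\<lambda>s. (norm (w s))\<^sup>2" "{0..T}"] xw
      by (fastforce simp: arc_def L2_on_def)
    have "T \<noteq> 0" using neg by (auto simp: total_supply_def)
    then have "T > 0" using T by simp
    \<comment> \<open>any unit vector serves\<close>
    define u :: "real^'w" where "u = axis undefined 1"
    obtain y where y: "y 0 = 0" "\<And>t. (y has_vector_derivative (A *v y t + B *v u)) (at t)"
      using constant_input_response_exists[where A = A and B = B and u = u and ?x0.0 = "0"] by metis
    have uy: "arc A B T 0 (\<lambda>_. u) y" by (rule arc_constant_input[OF y T])
    have Nu: "integral {0..T} (\<lambda>s. (norm u)\<^sup>2) > 0"
      using \<open>T > 0\<close> by (simp add: u_def)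
    have perturbed: "0 \<le> total_supply C D g T (\<lambda>s. u + c *\<^sub>R w s) (\<lambda>s. y s + c *\<^sub>R x s)" for c
    proof (rule active)
      have cw: "arc A B T 0 (\<lambda>s. c *\<^sub>R w s) (\<lambda>s. c *\<^sub>R x s)" for c
        using arc_scaleR[OF xw, of c] by simp
      show ucw: "arc A B T 0 (\<lambda>s. u + c *\<^sub>R w s) (\<lambda>s. y s + c *\<^sub>R x s)"
        using arc_add[OF uy cw] by simp
      have "integral {0..T} (\<lambda>s. (norm ((u + c *\<^sub>R w s) + (- c) *\<^sub>R w s))\<^sup>2)
          \<le> 2 * integral {0..T} (\<lambda>s. (norm (u + c *\<^sub>R w s))\<^sup>2)
            + 2 * integral {0..T} (\<lambda>s. (norm ((- c) *\<^sub>R w s))\<^sup>2)"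
        using ucw cw[of "- c"] by (intro integral_norm_add_sq_le) (auto simp only: arc_def)
      also have "integral {0..T} (\<lambda>s. (norm ((- c) *\<^sub>R w s))\<^sup>2) = 0"
        using N0 by (simp add: power_mult_distrib)
      finally show "0 < integral {0..T} (\<lambda>s. (norm (u + c *\<^sub>R w s))\<^sup>2)" using Nu by simp
    qed
    \<comment> \<open>average over \<open>c\<close> and \<open>-c\<close>: the mixed terms cancel\<close>
    have bound: "0 \<le> total_supply C D g T (\<lambda>_. u) y + c\<^sup>2 * total_supply C D g T w x" for c
      using total_supply_parallelogram[OF uy arc_scaleR[OF xw, of c], of C D g]
        perturbed[of c] perturbed[of "- c"]
      by (simp add: total_supply_scaleR)
    define m where "m = total_supply C D g T (\<lambda>_. u) y"
    define d where "d = - total_supply C D g T w x"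
    have "d > 0" using neg by (simp add: d_def)
    have "m \<ge> 0" using bound[of 0] by (simp add: m_def)
    \<comment> \<open>at this \<open>c\<close> the bound becomes \<open>m - (m + 1) \<ge> 0\<close>\<close>
    have "(sqrt ((m + 1) / d))\<^sup>2 * d = m + 1" using \<open>d > 0\<close> \<open>m \<ge> 0\<close> by simp
    then show False using bound[of "sqrt ((m + 1) / d)"] by (simp add: m_def d_def)
  qed
qed

section \<open>The required supply\<close>

text \<open>The two properties that make the required supply a well-behaved infimum: its set of competitors
  is bounded below and nonempty at every state.\<close>

locale dissipative_reachable =
  fixes A :: "real^'n^'n" and B :: "real^'w^'n" and C :: "real^'n^'z" and D :: "real^'w^'z"
    and g :: real
  assumes supply_nonneg: "\<And>T w x. arc A B T 0 w x \<Longrightarrow> 0 \<le> total_supply C D g T w x"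
    and reachable: "\<And>\<xi>. \<exists>T w x. arc A B T 0 w x \<and> x T = \<xi>"
begin

definition required_supply :: "real^'n \<Rightarrow> real" where
  "required_supply \<xi> = Inf {total_supply C D g T w x | T w x. arc A B T 0 w x \<and> x T = \<xi>}"

lemma required_supply_le:
  assumes "arc A B T 0 w x" "x T = \<xi>"
  shows "required_supply \<xi> \<le> total_supply C D g T w x"
  unfolding required_supply_def
proof (rule cInf_lower)
  show "bdd_below {total_supply C D g T w x | T w x. arc A B T 0 w x \<and> x T = \<xi>}"
    using supply_nonneg by (intro bdd_belowI[of _ 0]) blast
qed (use assms in blast)

lemma required_supply_greatest:
  assumes "\<And>T w x. arc A B T 0 w x \<Longrightarrow> x T = \<xi> \<Longrightarrow> c \<le> total_supply C D g T w x"
  shows "c \<le> required_supply \<xi>"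
  unfolding required_supply_def using assms reachable[of \<xi>] by (intro cInf_greatest) auto

lemma required_supply_approx:
  assumes "0 < e"
  obtains T w x where "arc A B T 0 w x" "x T = \<xi>" "total_supply C D g T w x < required_supply \<xi> + e"
  using required_supply_greatest[of \<xi> "required_supply \<xi> + e"] assms by (meson add_le_same_cancel1 linorder_not_le)

lemma required_supply_nonneg: "0 \<le> required_supply \<xi>"
  using supply_nonneg by (rule required_supply_greatest)

lemma required_supply_scaleR: "required_supply (c *\<^sub>R \<xi>) = c\<^sup>2 * required_supply \<xi>"
proof -
  have zero: "required_supply 0 = 0"
  proof (rule antisym)
    have "total_supply C D g 0 (\<lambda>_. 0 :: real^'w) (\<lambda>_. 0 :: real^'n) = 0"
      by (simp add: total_supply_def)
    then show "required_supply 0 \<le> 0"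
      using required_supply_le[OF arc_zero[of 0], of 0] by simp
  qed (rule required_supply_nonneg)
  have le: "required_supply (c *\<^sub>R \<xi>) / c\<^sup>2 \<le> required_supply \<xi>" if "c \<noteq> 0" for c \<xi>
  proof (rule required_supply_greatest)
    fix T w x assume xw: "arc A B T 0 w x" "x T = \<xi>"
    have "required_supply (c *\<^sub>R \<xi>) \<le> c\<^sup>2 * total_supply C D g T w x"
      using required_supply_le[of T "\<lambda>s. c *\<^sub>R w s" "\<lambda>s. c *\<^sub>R x s"] arc_scaleR[OF xw(1), of c] xw(2)
      by (simp add: total_supply_scaleR)
    then show "required_supply (c *\<^sub>R \<xi>) / c\<^sup>2 \<le> total_supply C D g T w x"
      using that by (simp add: divide_le_eq mult.commute)
  qed
  show ?thesis
  proof (cases "c = 0")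
    case False
    then have "required_supply (c *\<^sub>R \<xi>) \<le> c\<^sup>2 * required_supply \<xi>"
      using le[of c \<xi>] by (simp add: divide_le_eq mult.commute)
    moreover have "c\<^sup>2 * required_supply \<xi> \<le> required_supply (c *\<^sub>R \<xi>)"
      using le[of "inverse c" "c *\<^sub>R \<xi>"] False by (simp add: power_inverse field_simps)
    ultimately show ?thesis by simp
  qed (simp add: zero)
qed

text \<open>Waiting at the origin costs nothing. This allows two trajectories of different lengths to be
  added.\<close>

lemma delayed_arc_exists:
  assumes xw: "arc A B T 0 w x" and "T \<le> T'"
  obtains w' x' where "arc A B T' 0 w' x'" "x' T' = x T"
    "total_supply C D g T' w' x' = total_supply C D g T w x"
proof
  let ?d = "T' - T"
  have d: "0 \<le> ?d" using assms by simp
  show "arc A B T' 0 (concat_at ?d (\<lambda>_. 0) w) (concat_at ?d (\<lambda>_. 0) x)"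
    using arc_concat[OF arc_zero[OF d] xw] by simp
  have "0 \<le> T" using xw by (rule arc_nonneg)
  \<comment> \<open>for \<open>T = 0\<close> the final time is the junction, where the waiting signal is used; both values are \<open>0\<close>\<close>
  then show "concat_at ?d (\<lambda>_. 0) x T' = x T"
    using arc_initial[OF xw] by (cases "T = 0") (auto simp: concat_at_def)
  show "total_supply C D g T' (concat_at ?d (\<lambda>_. 0) w) (concat_at ?d (\<lambda>_. 0) x) = total_supply C D g T w x"
    using total_supply_concat[OF arc_zero[OF d] xw, of C D g]
    by (simp add: total_supply_def supply_rate_def)
qed

text \<open>Sum and difference of two nearly optimal trajectories to \<open>\<xi>\<close> and \<open>\<eta>\<close> compete for \<open>\<xi> + \<eta>\<close> and \<open>\<xi> - \<eta>\<close>.\<close>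

lemma required_supply_parallelogram_le:
  "required_supply (\<xi> + \<eta>) + required_supply (\<xi> - \<eta>) \<le> 2 * required_supply \<xi> + 2 * required_supply \<eta>"
proof (rule field_le_epsilon)
  fix e :: real assume "0 < e"
  then have e: "0 < e / 4" by simp
  obtain T1 w1 x1 where 1: "arc A B T1 0 w1 x1" "x1 T1 = \<xi>"
    "total_supply C D g T1 w1 x1 < required_supply \<xi> + e / 4"
    by (rule required_supply_approx[OF e])
  obtain T2 w2 x2 where 2: "arc A B T2 0 w2 x2" "x2 T2 = \<eta>"
    "total_supply C D g T2 w2 x2 < required_supply \<eta> + e / 4"
    by (rule required_supply_approx[OF e])
  define T where "T = max T1 T2"
  obtain w x where xw: "arc A B T 0 w x" "x T = \<xi>" "total_supply C D g T w x < required_supply \<xi> + e / 4"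
    using delayed_arc_exists[OF 1(1), of T] 1(2,3) by (metis T_def max.cobounded1)
  obtain v y where yv: "arc A B T 0 v y" "y T = \<eta>" "total_supply C D g T v y < required_supply \<eta> + e / 4"
    using delayed_arc_exists[OF 2(1), of T] 2(2,3) by (metis T_def max.cobounded2)
  have "required_supply (\<xi> + \<eta>) \<le> total_supply C D g T (\<lambda>s. w s + v s) (\<lambda>s. x s + y s)"
    using required_supply_le[OF arc_add[OF xw(1) yv(1), simplified]] xw(2) yv(2) by simp
  moreover have "required_supply (\<xi> - \<eta>) \<le> total_supply C D g T (\<lambda>s. w s - v s) (\<lambda>s. x s - y s)"
    using required_supply_le[OF arc_diff[OF xw(1) yv(1), simplified]] xw(2) yv(2) by simp
  ultimately show "required_supply (\<xi> + \<eta>) + required_supply (\<xi> - \<eta>)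
      \<le> 2 * required_supply \<xi> + 2 * required_supply \<eta> + e"
    using total_supply_parallelogram[OF xw(1) yv(1), of C D g] xw(3) yv(3) by linarith
qed

text \<open>The reverse inequality is the first one applied to \<open>\<xi> + \<eta>\<close> and \<open>\<xi> - \<eta>\<close>, whose sum and
  difference are \<open>2\<xi>\<close> and \<open>2\<eta>\<close>.\<close>

lemma required_supply_parallelogram:
  "required_supply (\<xi> + \<eta>) + required_supply (\<xi> - \<eta>) = 2 * required_supply \<xi> + 2 * required_supply \<eta>"
proof (rule antisym[OF required_supply_parallelogram_le])
  have "(\<xi> + \<eta>) + (\<xi> - \<eta>) = 2 *\<^sub>R \<xi>" "(\<xi> + \<eta>) - (\<xi> - \<eta>) = 2 *\<^sub>R \<eta>"
    by (simp_all add: scaleR_2)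
  then show "2 * required_supply \<xi> + 2 * required_supply \<eta>
      \<le> required_supply (\<xi> + \<eta>) + required_supply (\<xi> - \<eta>)"
    using required_supply_parallelogram_le[of "\<xi> + \<eta>" "\<xi> - \<eta>"]
    by (simp add: required_supply_scaleR)
qed

text \<open>The dissipation inequality: a nearly optimal trajectory to \<open>\<xi>\<close> followed by the given arc competes
  for the end point of the arc.\<close>

lemma required_supply_dissipation:
  assumes yv: "arc A B h \<xi> v y"
  shows "required_supply (y h) \<le> required_supply \<xi> + total_supply C D g h v y"
proof (rule field_le_epsilon)
  fix e :: real assume "0 < e"
  then obtain T w x where xw: "arc A B T 0 w x" "x T = \<xi>"
    "total_supply C D g T w x < required_supply \<xi> + e"
    by (rule required_supply_approx)
  have "0 \<le> h" using yv by (rule arc_nonneg)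
  have "arc A B (T + h) 0 (concat_at T w v) (concat_at T x y)"
    using arc_concat[OF xw(1)] yv xw(2) by simp
  moreover have "concat_at T x y (T + h) = y h"
    using \<open>0 \<le> h\<close> arc_initial[OF yv] xw(2) by (cases "h = 0") (auto simp: concat_at_def)
  ultimately have "required_supply (y h) \<le> total_supply C D g (T + h) (concat_at T w v) (concat_at T x y)"
    by (rule required_supply_le)
  then show "required_supply (y h) \<le> required_supply \<xi> + total_supply C D g h v y + e"
    using total_supply_concat[OF xw(1) yv, of C D g] xw(3) by simp
qed

text \<open>The infinitesimal dissipation inequality. Along the response to a constant input, the supplied
  minus the stored quantity \<open>\<phi> h\<close> is smallest at \<open>h = 0\<close>, so its right derivative there is
  nonnegative.\<close>

lemma storage_matrix_exists:
  obtains P where "P \<in> PSD" "\<And>x u. 2 * (x \<bullet> (P *v (A *v x + B *v u))) \<le> supply_rate C D g u x"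
proof -
  obtain P where P: "P \<in> PSD" and V: "\<And>\<xi>. required_supply \<xi> = \<xi> \<bullet> (P *v \<xi>)"
    using parallelogram_imp_quadratic_form[of required_supply] required_supply_nonneg
      required_supply_scaleR required_supply_parallelogram by blast
  have sym: "(P *v a) \<bullet> b = a \<bullet> (P *v b)" for a b
    using P Sym_inner[of P a b] by (simp add: PSD_def)
  have "2 * (x0 \<bullet> (P *v (A *v x0 + B *v u))) \<le> supply_rate C D g u x0" for x0 u
  proof -
    obtain y where y: "y 0 = x0" "\<And>t. (y has_vector_derivative (A *v y t + B *v u)) (at t)"
      using constant_input_response_exists[where A = A and B = B and u = u and ?x0.0 = x0] by metis
    define \<phi> where "\<phi> h = total_supply C D g h (\<lambda>_. u) y - y h \<bullet> (P *v y h)" for h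
    have mono: "\<phi> 0 \<le> \<phi> h" if "0 \<le> h" for h
      using required_supply_dissipation[OF arc_constant_input[OF y that]] y(1)
      unfolding \<phi>_def V by (simp add: total_supply_def)
    have y_cont: "continuous_on {0..1} y"
      using y(2) by (meson continuous_at_imp_continuous_on has_vector_derivative_continuous)
    have "continuous_on {0..1} (\<lambda>s. C *v y s)"
      using linear_continuous_on_compose[OF y_cont, of "(*v) C"] by simp
    then have "continuous_on {0..1} (\<lambda>s. supply_rate C D g u (y s))"
      unfolding supply_rate_def by (intro continuous_intros)
    then have d_supply: "((\<lambda>h. total_supply C D g h (\<lambda>_. u) y) has_real_derivative
        supply_rate C D g u x0) (at 0 within {0..1})"
      unfolding total_supply_def y(1)[symmetric] by (rule integral_has_real_derivative) simp
    let ?f = "A *v x0 + B *v u"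
    have dy: "(y has_vector_derivative ?f) (at 0 within {0..1})"
      using has_vector_derivative_at_within[OF y(2)[of 0]] y(1) by simp
    have "((\<lambda>h. P *v y h) has_vector_derivative P *v ?f) (at 0 within {0..1})"
      by (rule bounded_linear.has_vector_derivative[OF matrix_vector_mul_bounded_linear dy])
    from bounded_bilinear.has_vector_derivative[OF bounded_bilinear_inner dy this]
    have "((\<lambda>h. y h \<bullet> (P *v y h)) has_real_derivative x0 \<bullet> (P *v ?f) + ?f \<bullet> (P *v x0))
        (at 0 within {0..1})"
      by (simp only: has_real_derivative_iff_has_vector_derivative y(1))
    moreover have "?f \<bullet> (P *v x0) = x0 \<bullet> (P *v ?f)"
      using sym[of x0 ?f] by (simp only: inner_commute)
    ultimately have "((\<lambda>h. y h \<bullet> (P *v y h)) has_real_derivative 2 * (x0 \<bullet> (P *v ?f)))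
        (at 0 within {0..1})"
      by (simp only: mult_2)
    from DERIV_diff[OF d_supply this]
    have d: "(\<phi> has_real_derivative supply_rate C D g u x0 - 2 * (x0 \<bullet> (P *v ?f))) (at 0 within {0..1})"
      by (simp only: \<phi>_def[abs_def])
    show ?thesis
    proof (rule ccontr)
      assume "\<not> ?thesis"
      then have "supply_rate C D g u x0 - 2 * (x0 \<bullet> (P *v (A *v x0 + B *v u))) < 0" by simp
      from has_real_derivative_neg_dec_right[OF d this] obtain r
        where r: "r > 0" "\<And>h. 0 < h \<Longrightarrow> h \<in> {0..1} \<Longrightarrow> h < r \<Longrightarrow> \<phi> h < \<phi> 0" by auto
      have "\<phi> (min (r / 2) 1) < \<phi> 0" using r(1) by (intro r(2)) auto
      moreover have "\<phi> 0 \<le> \<phi> (min (r / 2) 1)" using r(1) by (intro mono) simp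
      ultimately show False by simp
    qed
  qed
  then show ?thesis using that P by blast
qed

end


section \<open>The bounded real lemma and the comparison of the bounds\<close>

text \<open>The necessity part of the bounded real lemma. Controllability provides the trajectories from the
  origin to every state, the gain bound the nonnegativity of their supply.\<close>

lemma bounded_real_lmi:
  fixes A :: "real^'n^'n" and B :: "real^'w^'n" and C :: "real^'n^'z" and D :: "real^'w^'z"
  assumes ctrb: "controllable A B" and gain: "L2_gain A B C D \<le> ereal g" and g: "0 \<le> g"
  obtains P where "P \<in> PSD" "neg_semidef (lmi A B C D g P)"
proof -
  interpret dissipative_reachable A B C D g
  proof
    show "0 \<le> total_supply C D g T w x" if "arc A B T 0 w x" for T w x
      using gain g that by (rule total_supply_nonneg)
    fix \<xi> :: "real^'n"
    obtain T w x where "T > 0" "w \<in> L2" "state_trajectory A B 0 w x" "x T = \<xi>"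
      using ctrb unfolding controllable_def by blast
    then have "arc A B T 0 w x"
      by (auto simp: arc_def state_trajectory_def intro: L2_imp_L2_on)
    then show "\<exists>T w x. arc A B T 0 w x \<and> x T = \<xi>" using \<open>x T = \<xi>\<close> by blast
  qed
  obtain P where P: "P \<in> PSD" "\<And>x u. 2 * (x \<bullet> (P *v (A *v x + B *v u))) \<le> supply_rate C D g u x"
    using storage_matrix_exists by blast
  then have sym: "P \<in> Sym" by (simp add: PSD_def)
  have "v \<bullet> (lmi A B C D g P *v v) \<le> 0" for v
    using P(2)[of "upper v" "lower v"] by (simp add: lmi_form[OF sym] supply_rate_def)
  then have "neg_semidef (lmi A B C D g P)" using lmi_Sym[OF sym] by (simp add: neg_semidef_def)
  then show ?thesis using that P(1) by blast
qed

text \<open>Every \<open>g\<close> strictly above the gain is feasible with the multiplier \<open>Q = 0\<close>. Taking \<open>g\<close> strictly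
  above keeps it positive, as \<open>gamma_bound\<close> demands, also when the gain is zero.\<close>

lemma gamma_bound_le_L2_gain:
  fixes A :: "real^'n^'n" and B :: "real^'w^'n" and C :: "real^'n^'z" and D :: "real^'w^'z"
  assumes "controllable A B" and "0 \<in> K"
  shows "gamma_bound A B C D K \<le> L2_gain A B C D"
proof (rule dense_ge)
  fix e assume e: "L2_gain A B C D < e"
  show "gamma_bound A B C D K \<le> e"
  proof (cases e)
    case (real g)
    have "0 < g" using L2_gain_nonneg[of A B C D] e real by (metis ereal_less(2) le_less_trans)
    have "L2_gain A B C D \<le> ereal g" using e real by simp
    then obtain P where "P \<in> PSD" "neg_semidef (lmi A B C D g P)"
      using bounded_real_lmi[OF assms(1) _ less_imp_le[OF \<open>0 < g\<close>]] by blast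
    moreover have "block 0 0 0 (0 :: real^'w^'w) = (0 :: real^('n + 'w)^('n + 'w))"
      by (simp add: block_def vstack_def hstack_def vec_eq_iff split: sum.split)
    ultimately have "\<exists>P\<in>PSD. \<exists>Q\<in>K. neg_semidef (lmi A B C D g P + block 0 0 0 Q)"
      using assms(2) by (intro bexI[of _ P] bexI[of _ 0]) simp_all
    then show ?thesis
      unfolding gamma_bound_def real using \<open>0 < g\<close> by (intro Inf_lower) blast
  qed (use e in auto)
qed

theorem theorem2:
  fixes A :: "real^'n^'n" and B :: "real^'w^'n" and C :: "real^'n^'z" and D :: "real^'w^'z"
    and Ap :: "real^'p^'p" and Bp :: "real^'w^'p"
  assumes "hurwitz A"
    and "controllable A B"
    and "hurwitz Ap"
    and "metzler Ap"
    and "entrywise_nonneg Bp"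
  shows "(gamma_bound_aug A B C D Ap Bp COP \<le> gamma_bound A B C D COP
          \<and> gamma_bound A B C D COP \<le> L2_gain A B C D)
       \<and> (gamma_bound_aug A B C D Ap Bp (PSD + NN) \<le> gamma_bound A B C D (PSD + NN)
          \<and> gamma_bound A B C D (PSD + NN) \<le> L2_gain A B C D)"
  using \<open>controllable A B\<close>
  by (intro conjI gamma_bound_aug_le_gamma_bound gamma_bound_le_L2_gain COP_subset_Sym
      PSD_plus_NN_subset_Sym block_lower_COP block_lower_PSD_plus_NN zero_COP zero_PSD_plus_NN)

end
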